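(* Let $(X,V,W,S,\mathcal H_*,h,*,\Theta)$ satisfy the abstract symmetrization framework described in the context. Assume that $X$ is a reflexive Banach space, endowed with any Kadec norm $\|\cdot\|$. Let $f:X\to\mathbb R\cup\{+\infty\}$ be a proper, bounded below, lower semi-continuous functional such that $f(u^H)\le f(u)$ for all $u\in S$ and $H\in\mathcal H_*$. Let $u\in S$, $\rho>0$, $\sigma>0$ and $p\ge 1$ be such that $f(u)<\inf f+\sigma\rho^p$. Then there exist $v\in X$ and $\eta\in X$ such that: (a) $\|v-v^*\|_V<(K(C_\Theta+1)+1)\rho$; (b) $\|v-u\|<\rho+\|\mathbb T_\rho u-u\|$; (c) $\|\eta-u\|\le\rho+\|\mathbb T_\rho u-u\|$; (d) $f(v)<\inf f+\sigma\rho^p$; (e) $f(w)\ge f(v)+\sigma(\|v-\eta\|^p-\|w-\eta\|^p)$ for all $w\in X$. Here $K>0$ denotes the continuity constant of the injection $X\hookrightarrow V$.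
   Context: Abstract framework. $X,V,W$ are real Banach spaces with $X\subseteq V\subseteq W$, $X$ continuously embedded in $V$ and $V$ continuously embedded in $W$; $\|\cdot\|$ is the norm of $X$ and $K>0$ is a constant with $\|u\|_V\le K\|u\|$ for $u\in X$. $S\subseteq X$ carries the metric induced by $\|\cdot\|$, $\mathcal H_*$ is a path-connected topological space, and there are maps $*:S\to S$, $u\mapsto u^*$ (symmetrization) and $h:S\times\mathcal H_*\to S$, $(u,H)\mapsto u^H$ (polarization) such that: $h$ is continuous; $(u^* )^H=(u^H)^*=u^*$ and $(u^H)^H=u^H$ for all $u\in S$, $H\in\mathcal H_*$; there is a sequence $(H_m)\subset\mathcal H_*$ such that for every $u\in S$ the iterated polarizations $u^{H_1\cdots H_m}$ converge to $u^*$ in $V$ as $m\to\infty$; $\|u^H-v^H\|_V\le\|u-v\|_V$ for all $u,v\in S$, $H\in\mathcal H_*$. Moreover $\Theta:(X,\|\cdot\|_V)\to(S,\|\cdot\|_V)$ is Lipschitz with constant $C_\Theta>0$ and $\Theta|_S=\mathrm{Id}|_S$; for $u\in X$ one sets $u^H:=(\Theta(u))^H$ and $u^*:=(\Theta(u))^*$. For every $\rho>0$, $\mathbb T_\rho:S\to S$ denotes a continuous map such that, for every $u\in S$, $\mathbb T_\rho u$ is obtained from $u$ by finitely many iterated polarizations by elements of $\mathcal H_*$, and $\|\mathbb T_\rho u-u^*\|_V<\rho$ (such maps are known to exist in this framework). A norm $\|\cdot\|$ on $X$ is a Kadec norm if the weak and norm topologies agree on the unit sphere of $X$. Proper means not identically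 $+\infty$. *)

theory Defs
  imports "HOL-Analysis.Analysis"
begin

definition weak_topology :: "'a::real_normed_vector topology" where
  "weak_topology =
     topology_generated_by {blinfun_apply \<phi> -` U | (\<phi> :: 'a \<Rightarrow>\<^sub>L real) U. open U}"

text \<open>Surjectivity of the canonical evaluation map into the bidual.\<close>

definition reflexive_space :: "'a::real_normed_vector itself \<Rightarrow> bool" where
  "reflexive_space _ \<longleftrightarrow>
     (\<forall>\<Phi> :: ('a \<Rightarrow>\<^sub>L real) \<Rightarrow>\<^sub>L real. \<exists>x :: 'a. \<forall>\<phi>. blinfun_apply \<Phi> \<phi> = blinfun_apply \<phi> x)"

definition kadec_norm :: "'a::real_normed_vector itself \<Rightarrow> bool" where
  "kadec_norm _ \<longleftrightarrow>
     subtopology weak_topology (sphere (0 :: 'a) 1) = top_of_set (sphere (0 :: 'a) 1)"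

definition lower_semicontinuous :: "('a::topological_space \<Rightarrow> ereal) \<Rightarrow> bool" where
  "lower_semicontinuous f \<longleftrightarrow> (\<forall>x. f x \<le> Liminf (at x) f)"

text \<open>\<open>iter_pol pol u [H1, \<dots>, Hm]\<close> polarizes \<open>u\<close> first by \<open>H1\<close> and last by \<open>Hm\<close>.\<close>

abbreviation iter_pol :: "('x \<Rightarrow> 'h \<Rightarrow> 'x) \<Rightarrow> 'x \<Rightarrow> 'h list \<Rightarrow> 'x" where
  "iter_pol pol u Hs \<equiv> foldl pol u Hs"

text \<open>
  The inclusions \<open>X \<subseteq> V \<subseteq> W\<close> are the injective bounded linear maps \<open>\<iota>\<close> and \<open>\<kappa>\<close>, so the norm of
  \<open>V\<close> restricted to \<open>X\<close> is \<open>norm (\<iota> u)\<close>. The type \<open>'x\<close> carries the norm of \<open>X\<close>, and \<open>top_of_set S\<close>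
  is the induced topology. The maps \<open>pol\<close> and \<open>star\<close> are only meaningful on \<open>S\<close>; on all of \<open>X\<close>
  polarization and symmetrization are \<open>pol (\<Theta> u) H\<close> and \<open>star (\<Theta> u)\<close>.
\<close>

locale symmetrization_framework =
  fixes \<iota> :: "'x::banach \<Rightarrow> 'v::banach"
    and \<kappa> :: "'v \<Rightarrow> 'w::banach"
    and K :: real
    and S :: "'x set"
    and \<H> :: "'h topology"
    and pol :: "'x \<Rightarrow> 'h \<Rightarrow> 'x"
    and star :: "'x \<Rightarrow> 'x"
    and \<Theta> :: "'x \<Rightarrow> 'x"
    and C :: real
  assumes X_in_V: "bounded_linear \<iota>" "inj \<iota>"
    and V_in_W: "bounded_linear \<kappa>" "inj \<kappa>"
    and K_pos: "K > 0"
    and K_bound: "\<And>u. norm (\<iota> u) \<le> K * norm u"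
    and path_connected: "path_connected_space \<H>"
    and star_closed: "\<And>u. u \<in> S \<Longrightarrow> star u \<in> S"
    and pol_continuous:
      "continuous_map (prod_topology (top_of_set S) \<H>) (top_of_set S) (\<lambda>(u, H). pol u H)"
    and pol_star: "\<And>u H. u \<in> S \<Longrightarrow> H \<in> topspace \<H> \<Longrightarrow> pol (star u) H = star u"
    and star_pol: "\<And>u H. u \<in> S \<Longrightarrow> H \<in> topspace \<H> \<Longrightarrow> star (pol u H) = star u"
    and pol_idem: "\<And>u H. u \<in> S \<Longrightarrow> H \<in> topspace \<H> \<Longrightarrow> pol (pol u H) H = pol u H"
    and iter_converges:
      "\<exists>Hseq :: nat \<Rightarrow> 'h. (\<forall>m. Hseq m \<in> topspace \<H>) \<and>
         (\<forall>u\<in>S. (\<lambda>m. \<iota> (iter_pol pol u (map Hseq [0..<m]))) \<longlonglongrightarrow> \<iota> (star u))"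
    and pol_nonexpansive:
      "\<And>u v H. u \<in> S \<Longrightarrow> v \<in> S \<Longrightarrow> H \<in> topspace \<H> \<Longrightarrow>
         norm (\<iota> (pol u H) - \<iota> (pol v H)) \<le> norm (\<iota> u - \<iota> v)"
    and C_pos: "C > 0"
    and Theta_closed: "\<And>u. \<Theta> u \<in> S"
    and Theta_lipschitz: "\<And>u v. norm (\<iota> (\<Theta> u) - \<iota> (\<Theta> v)) \<le> C * norm (\<iota> u - \<iota> v)"
    and Theta_id: "\<And>u. u \<in> S \<Longrightarrow> \<Theta> u = u"

end

(* The function w |-> f w + \<sigma> |w - \<eta>|^p attains its minimum for a dense set of \<eta>; choosing
   such an \<eta> close to \<open>T \<rho> u\<close> gives v, and nonexpansiveness of the symmetrization gives (a).
   Density rests on the value function of these problems in \<eta>, which is locally Lipschitz: it has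
   approximate Frechet subgradients at densely many points, because the supremum of its difference
   quotients over a ball is sublinear, and sublinear functions on a reflexive space have points of
   approximate smoothness (Baire category on a separable subspace with separable dual, so no smooth
   renorming is needed). An approximate subgradient at \<eta> nearly norms \<eta> - w for all near-minimizers
   w at once. By Baire category this holds to every accuracy on a dense set of \<eta>; there weak limits
   of minimizing sequences do not lose norm, and the Kadec property makes them norm limits. *)
theory Submission
  imports Defs
begin

text \<open>The obstacle is that \<open>f\<close> is lower semicontinuous for the norm only. A weak
  limit of a minimizing sequence says nothing about \<open>f\<close> unless the convergence is in
  norm, so for a fixed \<open>\<eta>\<close> the infimum need not be attained and
  \<open>\<eta>\<close> has to move. Density is what makes this harmless: the strict inequality
  assumed for \<open>f u\<close> pays for a small displacement of \<open>\<eta>\<close>. For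
  \<open>p = 1\<close> the penalty has a kink at 0, so near-minimizers close to
  \<open>\<eta>\<close> are separated from those at a distance where the penalty is continuously
  differentiable. The centre is \<open>T \<rho> u\<close> because polarizations do not raise
  \<open>f\<close>, so it inherits the bound, and because it lies within \<open>\<rho>\<close> of
  its own symmetrization in \<open>V\<close>. The constant in (a) adds \<open>K * \<rho>\<close> for
  passing from \<open>v\<close> to this centre, \<open>\<rho>\<close> for passing to its
  symmetrization, and \<open>C\<^sub>\<Theta> * K * \<rho>\<close> for passing to that of
  \<open>v\<close>.\<close>

section \<open>Sublinear functionals and the Hahn-Banach theorem\<close>

definition sublinear :: "('a::real_vector \<Rightarrow> real) \<Rightarrow> bool" where
  "sublinear s \<longleftrightarrow> (\<forall>x y. s (x + y) \<le> s x + s y) \<and> (\<forall>t>0. \<forall>x. s (t *\<^sub>R x) = t * s x)"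

lemma sublinearI:
  assumes "\<And>x y. s (x + y) \<le> s x + s y" and "\<And>t x. t > 0 \<Longrightarrow> s (t *\<^sub>R x) \<le> t * s x"
  shows "sublinear s"
proof -
  have "t * s x \<le> s (t *\<^sub>R x)" if "t > 0" for t x
    using assms(2)[of "1 / t" "t *\<^sub>R x"] that by (simp add: field_simps)
  with assms show ?thesis
    unfolding sublinear_def by (meson antisym)
qed

lemma sublinear_add: "sublinear s \<Longrightarrow> s (x + y) \<le> s x + s y"
  by (simp add: sublinear_def)

lemma sublinear_scale: "sublinear s \<Longrightarrow> t > 0 \<Longrightarrow> s (t *\<^sub>R x) = t * s x"
  by (simp add: sublinear_def)

lemma sublinear_zero: "sublinear s \<Longrightarrow> s 0 = 0"
  using sublinear_scale[of s 2 0] by simp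

lemma sublinear_neg: "sublinear s \<Longrightarrow> - s (- x) \<le> s x"
  using sublinear_add[of s x "- x"] by (simp add: sublinear_zero)

text \<open>A linear functional below \<open>r\<close> is also below \<open>s\<close>, and
  \<open>r (- a) \<le> - s a\<close> leaves it only the value \<open>s a\<close> at
  \<open>a\<close>. One shift therefore prescribes a supporting point, and shifts in all directions
  detect a failure of additivity.\<close>

lemma sublinear_shift:
  fixes a x :: "'a::real_vector"
  assumes s: "sublinear s"
  defines "r \<equiv> \<lambda>x. INF t\<in>{0..}. s (x + t *\<^sub>R a) - t * s a"
  shows "sublinear r" "r x \<le> s x" "r (- a) \<le> - s a"
proof -
  \<comment> \<open>This bound does not depend on \<open>t\<close>, so the infimum defining
    \<open>r\<close> is that of a set bounded below.\<close>
  have lower: "- s (- x) \<le> s (x + t *\<^sub>R a) - t * s a" if "t \<ge> 0" for x t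
  proof -
    have "s (t *\<^sub>R a) = t * s a"
      using that s by (cases "t = 0") (auto simp: sublinear_zero sublinear_scale)
    moreover have "s (t *\<^sub>R a) \<le> s (x + t *\<^sub>R a) + s (- x)"
      using sublinear_add[OF s, of "x + t *\<^sub>R a" "- x"] by simp
    ultimately show ?thesis by simp
  qed
  have upper: "r x \<le> s (x + t *\<^sub>R a) - t * s a" if "t \<ge> 0" for x t
    unfolding r_def
    by (rule cINF_lower) (use that lower in \<open>auto intro!: bdd_belowI2\<close>)
  have glb: "c \<le> r x" if "\<And>t. t \<ge> 0 \<Longrightarrow> c \<le> s (x + t *\<^sub>R a) - t * s a" for x c
    unfolding r_def by (rule cINF_greatest) (use that in auto)
  show "r x \<le> s x" using upper[of 0 x] by simp
  show "r (- a) \<le> - s a" using upper[of 1 "- a"] by (simp add: sublinear_zero[OF s])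
  show "sublinear r"
  proof (rule sublinearI)
    fix x y
    have "r (x + y) - (s (x + t *\<^sub>R a) - t * s a) \<le> r y" if t: "t \<ge> 0" for t
    proof (rule glb)
      fix u :: real assume u: "u \<ge> 0"
      have "r (x + y) \<le> s (x + y + (t + u) *\<^sub>R a) - (t + u) * s a"
        using t u by (intro upper) simp
      also have "s (x + y + (t + u) *\<^sub>R a) \<le> s (x + t *\<^sub>R a) + s (y + u *\<^sub>R a)"
        using sublinear_add[OF s, of "x + t *\<^sub>R a" "y + u *\<^sub>R a"]
        by (simp add: algebra_simps)
      finally show "r (x + y) - (s (x + t *\<^sub>R a) - t * s a) \<le> s (y + u *\<^sub>R a) - u * s a"
        by (simp add: algebra_simps)
    qed
    then have "r (x + y) - r y \<le> r x"
      by (intro glb) (simp add: algebra_simps)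
    then show "r (x + y) \<le> r x + r y" by simp
  next
    fix c :: real and x assume c: "c > 0"
    have "r (c *\<^sub>R x) / c \<le> r x"
    proof (rule glb)
      fix t :: real assume t: "t \<ge> 0"
      have "r (c *\<^sub>R x) \<le> s (c *\<^sub>R x + (c * t) *\<^sub>R a) - (c * t) * s a"
        using c t by (intro upper) simp
      also have "s (c *\<^sub>R x + (c * t) *\<^sub>R a) = c * s (x + t *\<^sub>R a)"
        using sublinear_scale[OF s c, of "x + t *\<^sub>R a"] by (simp add: algebra_simps)
      finally show "r (c *\<^sub>R x) / c \<le> s (x + t *\<^sub>R a) - t * s a"
        using c by (simp add: field_simps)
    qed
    then show "r (c *\<^sub>R x) \<le> c * r x" using c by (simp add: field_simps)
  qed
qed

text \<open>Zorn's lemma is applied to the reversed order. The pointwise infimum of a chain is a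
  lower bound: \<open>- s (- x)\<close> keeps it finite, and comparability of the members preserves
  subadditivity.\<close>

lemma minimal_sublinear_exists:
  assumes s: "sublinear s"
  shows "\<exists>q. sublinear q \<and> q \<le> s \<and> (\<forall>r. sublinear r \<longrightarrow> r \<le> q \<longrightarrow> r = q)"
proof -
  let ?A = "{q. sublinear q \<and> q \<le> s}"
  have "\<exists>m\<in>?A. \<forall>a\<in>?A. m \<ge> a \<longrightarrow> a = m"
  proof (rule predicate_Zorn)
    show "partial_order_on ?A (relation_of (\<ge>) ?A)"
      by (rule partial_order_on_relation_ofI) auto
    fix C assume C: "C \<in> Chains (relation_of (\<ge>) ?A)"
    have CA: "sublinear q" "q \<le> s" if "q \<in> C" for q
      using C that by (auto simp: Chains_def relation_of_def)
    have chain: "q \<le> r \<or> r \<le> q" if "q \<in> C" "r \<in> C" for q r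
      using C that by (auto simp: Chains_def relation_of_def)
    show "\<exists>u\<in>?A. \<forall>a\<in>C. u \<le> a"
    proof (cases "C = {}")
      case True
      with s show ?thesis by auto
    next
      case False
      define m where "m = (\<lambda>x. INF q\<in>C. q x)"
      have bdd: "bdd_below ((\<lambda>q. q x) ` C)" for x
      proof (rule bdd_belowI2)
        fix q assume "q \<in> C"
        then show "- s (- x) \<le> q x"
          using CA[of q] sublinear_neg[of q x] le_funD[of q s "- x"] by fastforce
      qed
      have upper: "m x \<le> q x" if "q \<in> C" for q x
        unfolding m_def using bdd that by (rule cINF_lower)
      have glb: "c \<le> m x" if "\<And>q. q \<in> C \<Longrightarrow> c \<le> q x" for c x
        unfolding m_def using False that by (rule cINF_greatest)
      have "sublinear m"
      proof (rule sublinearI)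
        fix x y
        \<comment> \<open>Independent choices \<open>q\<close> for \<open>x\<close> and
          \<open>r\<close> for \<open>y\<close> are replaced by the smaller of the two, which serves
          both points.\<close>
        have pair: "m (x + y) \<le> q x + r y" if qr: "q \<in> C" "r \<in> C" for q r
        proof -
          obtain t where t: "t \<in> C" "t \<le> q" "t \<le> r"
            using chain[OF qr] qr by blast
          have "m (x + y) \<le> t x + t y"
            using upper[OF t(1)] sublinear_add[OF CA(1)[OF t(1)]] order_trans by blast
          also have "\<dots> \<le> q x + r y" using t by (intro add_mono) (auto dest: le_funD)
          finally show ?thesis .
        qed
        have "m (x + y) - q x \<le> m y" if "q \<in> C" for q
          using pair[OF that] by (intro glb) (simp add: algebra_simps)
        then have "m (x + y) - m y \<le> m x"
          by (intro glb) (simp add: algebra_simps)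
        then show "m (x + y) \<le> m x + m y" by simp
      next
        fix t :: real and x assume t: "t > 0"
        have "m (t *\<^sub>R x) / t \<le> m x"
        proof (rule glb)
          fix q assume "q \<in> C"
          then show "m (t *\<^sub>R x) / t \<le> q x"
            using upper[of q "t *\<^sub>R x"] sublinear_scale[OF CA(1) t, of q x] t
            by (simp add: field_simps)
        qed
        then show "m (t *\<^sub>R x) \<le> t * m x" using t by (simp add: field_simps)
      qed
      moreover have "m \<le> s"
      proof -
        obtain q where "q \<in> C" using False by blast
        then show ?thesis
          using CA(2)[of q] upper[of q] by (auto simp: le_fun_def intro: order_trans)
      qed
      ultimately show ?thesis using upper by (auto simp: le_fun_def)
    qed
  qed
  then obtain m where m: "sublinear m" "m \<le> s" "\<And>a. sublinear a \<Longrightarrow> a \<le> s \<Longrightarrow> a \<le> m \<Longrightarrow> a = m"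
    by blast
  then show ?thesis
    by (intro exI[of _ m]) (blast intro: order_trans)
qed

text \<open>A minimal sublinear functional is additive, because \<open>sublinear_shift\<close> cannot lower it.\<close>

theorem Hahn_Banach_supporting:
  assumes s: "sublinear s"
  obtains \<phi> where "linear \<phi>" "\<And>x. \<phi> x \<le> s x" "\<phi> a = s a"
proof -
  \<comment> \<open>Starting below \<open>r\<close> instead of \<open>s\<close> builds the
    prescribed value at \<open>a\<close> into the minimal functional.\<close>
  define r where "r = (\<lambda>x. INF t\<in>{0..}. s (x + t *\<^sub>R a) - t * s a)"
  have r: "sublinear r" "\<And>x. r x \<le> s x" "r (- a) \<le> - s a"
    unfolding r_def by (fact sublinear_shift[OF s])+
  obtain q where q: "sublinear q" "q \<le> r" and min: "\<And>q'. sublinear q' \<Longrightarrow> q' \<le> q \<Longrightarrow> q' = q"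
    using minimal_sublinear_exists[OF r(1)] by blast
  have add: "q (x + y) = q x + q y" for x y
  proof -
    note sh = sublinear_shift[OF q(1), where a = y]
    have "q (- y) \<le> - q y"
      using fun_cong[OF min[OF sh(1) le_funI[OF sh(2)]], of "- y"] sh(3) by simp
    then have "q x + q y \<le> q (x + y)" 
      using sublinear_add[OF q(1), of "x + y" "- y"] by simp
    with sublinear_add[OF q(1), of x y] show ?thesis by simp
  qed
  have neg: "q (- x) = - q x" for x
    using add[of x "- x"] sublinear_zero[OF q(1)] by simp
  have scale: "q (t *\<^sub>R x) = t * q x" for t x
  proof -
    consider "t > 0" | "t = 0" | "t < 0" by linarith
    then show ?thesis
    proof cases
      case 3
      then have "q ((- t) *\<^sub>R x) = - t * q x" by (intro sublinear_scale q) simp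
      then show ?thesis using neg[of "t *\<^sub>R x"] by simp
    qed (simp_all add: sublinear_scale sublinear_zero q)
  qed
  show ?thesis
  proof
    show "linear q" by (rule linearI) (simp_all add: add scale)
    show le: "q x \<le> s x" for x
      using le_funD[OF q(2), of x] r(2) by (rule order_trans)
    have "- q a \<le> - s a"
      using r(3) le_funD[OF q(2), of "- a"] neg[of a] by simp
    with le[of a] show "q a = s a" by simp
  qed
qed

text \<open>A one-sided bound suffices: applied at \<open>x\<close> and \<open>- x\<close> it bounds
  a linear functional from both sides.\<close>

lemma Hahn_Banach_supporting_blinfun:
  fixes s :: "'a::real_normed_vector \<Rightarrow> real"
  assumes s: "sublinear s" and L: "\<And>x. s x \<le> L * norm x"
  obtains \<phi> :: "'a \<Rightarrow>\<^sub>L real" where "\<And>x. blinfun_apply \<phi> x \<le> s x" "blinfun_apply \<phi> a = s a"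
proof -
  obtain q where q: "linear q" "\<And>x. q x \<le> s x" "q a = s a"
    using Hahn_Banach_supporting[OF s, of a] by blast
  have le: "q x \<le> L * norm x" for x using q(2) L order_trans by blast
  have "\<bar>q x\<bar> \<le> norm x * L" for x
    using le[of x] le[of "- x"] linear_neg[OF q(1), of x] by (simp add: mult.commute abs_le_iff)
  then have "bounded_linear q"
    using q(1) by (intro bounded_linear_intro[of _ L]) (auto simp: linear_add linear_scale)
  then show ?thesis using that[of "Blinfun q"] q by (simp add: bounded_linear_Blinfun_apply)
qed

lemma sublinear_norm: "sublinear norm"
  by (rule sublinearI) (auto intro: norm_triangle_ineq)

lemma norming_functional:
  fixes a :: "'a::real_normed_vector"
  obtains \<phi> :: "'a \<Rightarrow>\<^sub>L real" where "norm \<phi> \<le> 1" "blinfun_apply \<phi> a = norm a"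
proof -
  obtain \<phi> :: "'a \<Rightarrow>\<^sub>L real" where p: "\<And>x. blinfun_apply \<phi> x \<le> norm x" "blinfun_apply \<phi> a = norm a"
    using Hahn_Banach_supporting_blinfun[OF sublinear_norm, of 1] by auto
  have "\<bar>blinfun_apply \<phi> x\<bar> \<le> 1 * norm x" for x
    using p(1)[of x] p(1)[of "- x"] by (simp add: blinfun.minus_right abs_le_iff)
  then have "norm \<phi> \<le> 1" by (intro norm_blinfun_bound) auto
  with p that show ?thesis by blast
qed

section \<open>Ultrafilters and weak limits\<close>

text \<open>Smaller filters are finer, so a minimal proper filter is an ultrafilter: intersecting it
  with the principal filter of \<open>P\<close> gives either the improper filter or the same filter
  again.\<close>

lemma ultrafilter_exists:
  assumes F: "F \<noteq> bot"
  obtains U where "U \<noteq> bot" "U \<le> F" "\<And>P. eventually P U \<or> eventually (\<lambda>x. \<not> P x) U"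
proof -
  let ?A = "{G. G \<noteq> bot \<and> G \<le> F}"
  have "\<exists>m\<in>?A. \<forall>a\<in>?A. m \<ge> a \<longrightarrow> a = m"
  proof (rule predicate_Zorn)
    show "partial_order_on ?A (relation_of (\<ge>) ?A)"
      by (rule partial_order_on_relation_ofI) auto
    fix C assume C: "C \<in> Chains (relation_of (\<ge>) ?A)"
    have CA: "G \<noteq> bot" "G \<le> F" if "G \<in> C" for G
      using C that by (auto simp: Chains_def relation_of_def)
    have chain: "G \<le> H \<or> H \<le> G" if "G \<in> C" "H \<in> C" for G H
      using C that by (auto simp: Chains_def relation_of_def)
    show "\<exists>u\<in>?A. \<forall>a\<in>C. u \<le> a"
    proof (cases "C = {}")
      case True
      with F show ?thesis by auto
    next
      case False
      have "\<exists>x\<in>C. x \<le> inf G H" if "G \<in> C" "H \<in> C" for G H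
        using chain[OF that] that by (metis inf.orderE inf.commute order_refl)
      then have "eventually P (Inf C) \<longleftrightarrow> (\<exists>b\<in>C. eventually P b)" for P
        using eventually_Inf_base[OF False] by blast
      then have "Inf C \<noteq> bot"
        using CA(1) by (metis trivial_limit_def)
      moreover have "Inf C \<le> F"
        using False CA(2) by (meson Inf_lower ex_in_conv order_trans)
      ultimately show ?thesis using Inf_lower by blast
    qed
  qed
  then obtain U where U: "U \<noteq> bot" "U \<le> F" "\<And>G. G \<noteq> bot \<Longrightarrow> G \<le> F \<Longrightarrow> G \<le> U \<Longrightarrow> G = U"
    by blast
  have "eventually P U \<or> eventually (\<lambda>x. \<not> P x) U" for P
  proof (cases "inf U (principal {x. P x}) = bot")
    case True
    then have "eventually (\<lambda>x. False) (inf U (principal {x. P x}))" by simp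
    then show ?thesis by (simp add: eventually_inf_principal)
  next
    case False
    then have "inf U (principal {x. P x}) = U"
      using U(2) by (intro U(3)) (auto intro: le_infI1)
    then have "U \<le> principal {x. P x}" by (metis inf.cobounded2)
    then show ?thesis by (simp add: le_principal)
  qed
  with U that show ?thesis by blast
qed

text \<open>Compactness of an interval gives a cluster point, and an ultrafilter converges to its
  cluster points because it decides every neighbourhood.\<close>

lemma ultrafilter_convergent:
  fixes r :: "'i \<Rightarrow> real"
  assumes U: "U \<noteq> bot" "\<And>P. eventually P U \<or> eventually (\<lambda>x. \<not> P x) U"
    and bnd: "\<And>i. \<bar>r i\<bar> \<le> B"
  shows "\<exists>l. (r \<longlongrightarrow> l) U"
proof -
  let ?G = "filtermap r U"
  have "eventually (\<lambda>x. x \<in> {- B..B}) ?G" "?G \<noteq> bot"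
    using U(1) bnd by (auto simp: eventually_filtermap filtermap_bot_iff abs_le_iff minus_le_iff)
  then obtain l where l: "inf (nhds l) ?G \<noteq> bot"
    using compact_Icc[of "- B" B] unfolding compact_filter by blast
  have "?G \<le> nhds l"
  proof (rule filter_leI)
    fix P assume P: "eventually P (nhds l)"
    have "\<not> eventually (\<lambda>x. \<not> P (r x)) U"
    proof
      assume "eventually (\<lambda>x. \<not> P (r x)) U"
      then have "eventually (\<lambda>x. \<not> P x) ?G" by (simp add: eventually_filtermap)
      with P have "eventually (\<lambda>x. False) (inf (nhds l) ?G)"
        unfolding eventually_inf by blast
      with l show False by (simp add: trivial_limit_def)
    qed
    with U(2)[of "\<lambda>x. P (r x)"] show "eventually P ?G" by (simp add: eventually_filtermap)
  qed
  then show ?thesis by (auto simp: filterlim_def)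
qed

text \<open>The pointwise limits along \<open>U\<close> form a bounded linear functional on the
  dual, which reflexivity represents by a point. This gives weak compactness of balls without
  extracting subsequences.\<close>

lemma reflexive_weak_ultralimit:
  fixes z :: "'i \<Rightarrow> 'a::real_normed_vector"
  assumes refl: "reflexive_space TYPE('a)"
    and U: "U \<noteq> bot" "\<And>P. eventually P U \<or> eventually (\<lambda>x. \<not> P x) U"
    and bnd: "\<And>i. norm (z i) \<le> B"
  obtains q where "\<And>\<phi> :: 'a \<Rightarrow>\<^sub>L real. ((\<lambda>i. blinfun_apply \<phi> (z i)) \<longlongrightarrow> blinfun_apply \<phi> q) U"
proof -
  have b: "\<bar>blinfun_apply \<phi> (z i)\<bar> \<le> norm \<phi> * B" for \<phi> :: "'a \<Rightarrow>\<^sub>L real" and i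
    using norm_blinfun[of \<phi> "z i"] mult_left_mono[OF bnd[of i], of "norm \<phi>"] by simp
  have "\<forall>\<phi> :: 'a \<Rightarrow>\<^sub>L real. \<exists>l. ((\<lambda>i. blinfun_apply \<phi> (z i)) \<longlongrightarrow> l) U"
    by (intro allI ultrafilter_convergent[OF U b])
  then have "\<exists>\<Phi>. \<forall>\<phi> :: 'a \<Rightarrow>\<^sub>L real. ((\<lambda>i. blinfun_apply \<phi> (z i)) \<longlongrightarrow> \<Phi> \<phi>) U"
    by (rule choice)
  then obtain \<Phi> where \<Phi>: "\<And>\<phi> :: 'a \<Rightarrow>\<^sub>L real. ((\<lambda>i. blinfun_apply \<phi> (z i)) \<longlongrightarrow> \<Phi> \<phi>) U"
    by blast
  have "bounded_linear \<Phi>"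
  proof (rule bounded_linear_intro)
    fix \<phi> \<psi> :: "'a \<Rightarrow>\<^sub>L real" and t :: real
    show "\<Phi> (\<phi> + \<psi>) = \<Phi> \<phi> + \<Phi> \<psi>"
      using tendsto_add[OF \<Phi>[of \<phi>] \<Phi>[of \<psi>]] \<Phi>[of "\<phi> + \<psi>"]
      by (intro tendsto_unique[OF U(1)]) (auto simp: blinfun.add_left)
    show "\<Phi> (t *\<^sub>R \<phi>) = t *\<^sub>R \<Phi> \<phi>"
      using tendsto_mult_left[OF \<Phi>[of \<phi>], of t] \<Phi>[of "t *\<^sub>R \<phi>"]
      by (intro tendsto_unique[OF U(1)]) (auto simp: blinfun.scaleR_left)
    have "\<bar>\<Phi> \<phi>\<bar> \<le> norm \<phi> * B"
      by (rule tendsto_upperbound[OF tendsto_rabs[OF \<Phi>[of \<phi>]] _ U(1)]) (simp add: b)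
    then show "norm (\<Phi> \<phi>) \<le> norm \<phi> * B" by simp
  qed
  moreover obtain q where "blinfun_apply (Blinfun \<Phi>) \<phi> = blinfun_apply \<phi> q" for \<phi>
    using refl unfolding reflexive_space_def by blast
  ultimately have "\<Phi> \<phi> = blinfun_apply \<phi> q" for \<phi>
    by (simp add: bounded_linear_Blinfun_apply)
  with \<Phi> that[of q] show ?thesis by simp
qed

section \<open>Separable subspaces and separability of their duals\<close>

text \<open>Closure under \<open>g\<close> will put prescribed witnesses for each member into the
  set. Rational multiples keep it countable; its topological closure is later a real
  subspace.\<close>

lemma countable_rational_closure:
  fixes A :: "'a::real_vector set" and g :: "'a \<Rightarrow> nat \<Rightarrow> 'a"
  assumes A: "countable A"
  shows "\<exists>Q. countable Q \<and> A \<subseteq> Q \<and> (\<forall>x\<in>Q. \<forall>y\<in>Q. x + y \<in> Q) \<and>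
    (\<forall>r\<in>\<rat>. \<forall>x\<in>Q. r *\<^sub>R x \<in> Q) \<and> (\<forall>x\<in>Q. \<forall>n. g x n \<in> Q)"
proof -
  define step where "step = (\<lambda>B. B \<union> (\<lambda>(x, y). x + y) ` (B \<times> B)
    \<union> (\<lambda>(r, x). r *\<^sub>R x) ` (\<rat> \<times> B) \<union> (\<lambda>(x, n). g x n) ` (B \<times> UNIV))"
  have rat: "countable (\<rat> :: real set)" by (rule countable_rat)
  have count: "countable ((step ^^ n) A)" for n
    by (induction n) (auto simp: step_def A rat)
  have mono: "(step ^^ m) A \<subseteq> (step ^^ n) A" if "m \<le> n" for m n
    using that by (induction n rule: dec_induct) (auto simp: step_def)
  define Q where "Q = (\<Union>n. (step ^^ n) A)"
  have inQ: "x \<in> Q" if "x \<in> (step ^^ n) A" for x n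
    using that by (auto simp: Q_def)
  show ?thesis
  proof (intro exI[of _ Q] conjI ballI allI)
    show "countable Q" using count by (auto simp: Q_def)
    show "A \<subseteq> Q" using inQ[of _ 0] by auto
  next
    fix x assume "x \<in> Q"
    then obtain m where m: "x \<in> (step ^^ m) A" by (auto simp: Q_def)
    show "r *\<^sub>R x \<in> Q" if "r \<in> \<rat>" for r :: real
      by (rule inQ[of _ "Suc m"]) (use m that in \<open>auto simp: step_def\<close>)
    show "g x n \<in> Q" for n
      by (rule inQ[of _ "Suc m"]) (use m in \<open>auto simp: step_def\<close>)
    fix y assume "y \<in> Q"
    then obtain k where k: "y \<in> (step ^^ k) A" by (auto simp: Q_def)
    have "x \<in> (step ^^ max m k) A" "y \<in> (step ^^ max m k) A"
      using m k mono[of m "max m k"] mono[of k "max m k"] by auto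
    then show "x + y \<in> Q"
      by (intro inQ[of _ "Suc (max m k)"]) (auto simp: step_def)
  qed
qed

text \<open>The supporting functional of this distance at a point off a closed \<open>Y\<close>
  vanishes on \<open>Y\<close> but not at that point, so Hahn-Banach yields separation from
  subspaces.\<close>

lemma sublinear_infdist:
  assumes Y: "subspace Y"
  shows "sublinear (\<lambda>x :: 'a::real_normed_vector. infdist x Y)"
proof (rule sublinearI)
  have ne: "Y \<noteq> {}" using subspace_0[OF Y] by auto
  have approx: "\<exists>y\<in>Y. dist x y < infdist x Y + e" if "e > 0" for x and e :: real
  proof -
    have "Inf (dist x ` Y) < infdist x Y + e" using ne that by (simp add: infdist_notempty)
    then show ?thesis using cInf_lessD[of "dist x ` Y"] ne by blast
  qed
  fix x y :: 'a
  show "infdist (x + y) Y \<le> infdist x Y + infdist y Y"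
  proof (rule field_le_epsilon)
    fix e :: real assume "e > 0"
    then obtain u v where uv: "u \<in> Y" "dist x u < infdist x Y + e / 2"
      "v \<in> Y" "dist y v < infdist y Y + e / 2"
      using approx[of "e / 2" x] approx[of "e / 2" y] by auto
    have "infdist (x + y) Y \<le> dist (x + y) (u + v)"
      using uv Y by (intro infdist_le) (auto simp: subspace_add)
    also have "\<dots> \<le> dist x u + dist y v" by (rule dist_triangle_add)
    finally show "infdist (x + y) Y \<le> infdist x Y + infdist y Y + e" using uv by simp
  qed
  fix t :: real assume t: "t > 0"
  have "infdist (t *\<^sub>R x) Y / t \<le> infdist x Y"
  proof (rule field_le_epsilon)
    fix e :: real assume "e > 0"
    then obtain u where u: "u \<in> Y" "dist x u < infdist x Y + e" using approx by blast
    have "infdist (t *\<^sub>R x) Y \<le> dist (t *\<^sub>R x) (t *\<^sub>R u)"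
      using u Y by (intro infdist_le) (auto simp: subspace_scale)
    also have "\<dots> = t * dist x u"
      using t by (simp add: dist_norm flip: scaleR_diff_right)
    finally have "infdist (t *\<^sub>R x) Y / t \<le> dist x u" using t by (simp add: field_simps)
    with u show "infdist (t *\<^sub>R x) Y / t \<le> infdist x Y + e" by simp
  qed
  then show "infdist (t *\<^sub>R x) Y \<le> t * infdist x Y" using t by (simp add: field_simps)
qed

text \<open>Functionals norming a dense sequence have dense rational span, for otherwise reflexivity turns
  a functional annihilating that span into a point of the subspace that all of them annihilate.\<close>

lemma reflexive_separable_dual:
  fixes Y :: "'a::real_normed_vector set"
  assumes refl: "reflexive_space TYPE('a)"
    and Y: "subspace Y" "closed Y" and Q: "countable Q" "Y \<subseteq> closure Q"
  obtains D :: "('a \<Rightarrow>\<^sub>L real) set" where "countable D"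
    "\<And>\<phi> e. e > 0 \<Longrightarrow> \<exists>\<psi>\<in>D. \<forall>y\<in>Y. \<bar>blinfun_apply \<phi> y - blinfun_apply \<psi> y\<bar> \<le> e * norm y"
proof -
  have Y0: "0 \<in> Y" using Y(1) by (rule subspace_0)
  \<comment> \<open>The norm of the restriction to \<open>Y\<close>, hence only a seminorm on the
    dual of the whole space.\<close>
  define N where "N \<phi> = (SUP y\<in>Y \<inter> cball 0 1. \<bar>blinfun_apply \<phi> y\<bar>)" for \<phi> :: "'a \<Rightarrow>\<^sub>L real"
  have bound: "\<bar>blinfun_apply \<phi> y\<bar> \<le> norm \<phi>" if "y \<in> Y \<inter> cball 0 1" for \<phi> :: "'a \<Rightarrow>\<^sub>L real" and y
    using norm_blinfun[of \<phi> y] that mult_left_mono[of "norm y" 1 "norm \<phi>"] by simp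
  have N_least: "N \<phi> \<le> c" if "\<And>y. y \<in> Y \<Longrightarrow> norm y \<le> 1 \<Longrightarrow> \<bar>blinfun_apply \<phi> y\<bar> \<le> c" for \<phi> c
    unfolding N_def by (rule cSUP_least) (use that Y0 in auto)
  have N_unit: "\<bar>blinfun_apply \<phi> y\<bar> \<le> N \<phi>" if "y \<in> Y" "norm y \<le> 1" for \<phi> y
    unfolding N_def
    by (rule cSUP_upper) (use that bound in \<open>auto intro!: bdd_aboveI2[where M = "norm \<phi>"]\<close>)
  have N_norm: "N \<phi> \<le> norm \<phi>" for \<phi>
    by (rule N_least) (use bound in auto)
  have N_nonneg: "N \<phi> \<ge> 0" for \<phi> using N_unit[of 0 \<phi>] Y0 by simp
  have N_apply: "\<bar>blinfun_apply \<phi> y\<bar> \<le> N \<phi> * norm y" if "y \<in> Y" for \<phi> y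
  proof (cases "y = 0")
    case False
    have "\<bar>blinfun_apply \<phi> ((1 / norm y) *\<^sub>R y)\<bar> \<le> N \<phi>"
      using False that Y(1) by (intro N_unit) (auto simp: subspace_scale)
    then show ?thesis using False by (simp add: blinfun.scaleR_right abs_mult field_simps)
  qed simp
  have N_add: "N (\<phi> + \<psi>) \<le> N \<phi> + N \<psi>" for \<phi> \<psi>
  proof (rule N_least)
    fix y assume "y \<in> Y" "norm y \<le> 1"
    then show "\<bar>blinfun_apply (\<phi> + \<psi>) y\<bar> \<le> N \<phi> + N \<psi>"
      using N_unit[of y \<phi>] N_unit[of y \<psi>] by (simp add: blinfun.add_left)
  qed
  have N_scale: "N (t *\<^sub>R \<phi>) \<le> \<bar>t\<bar> * N \<phi>" for t \<phi>
    by (rule N_least) (use N_unit[of _ \<phi>] in \<open>auto simp: blinfun.scaleR_left abs_mult intro!: mult_left_mono\<close>)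
  have "\<forall>q. \<exists>\<phi> :: 'a \<Rightarrow>\<^sub>L real. norm \<phi> \<le> 1 \<and> blinfun_apply \<phi> q = norm q"
    using norming_functional by blast
  then obtain F :: "'a \<Rightarrow> 'a \<Rightarrow>\<^sub>L real"
    where F: "\<And>q. norm (F q) \<le> 1" "\<And>q. blinfun_apply (F q) q = norm q"
    using choice[of "\<lambda>q \<phi>. norm \<phi> \<le> 1 \<and> blinfun_apply \<phi> q = norm q"] by blast
  obtain D where D: "countable D" "insert 0 (F ` Q) \<subseteq> D" 
      "\<forall>x\<in>D. \<forall>y\<in>D. x + y \<in> D" "\<forall>r\<in>\<rat>. \<forall>x\<in>D. r *\<^sub>R x \<in> D"
    using countable_rational_closure[of "insert 0 (F ` Q)" "\<lambda>x n. x", OF countable_insert[OF countable_image[OF Q(1)]]]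
    by (elim exE conjE) (rule that)
  \<comment> \<open>The distance to \<open>D\<close> in the seminorm \<open>N\<close>. It is
    sublinear, so Hahn-Banach applies to it; the goal is that it is nowhere positive.\<close>
  define p where "p \<psi> = (INF m\<in>D. N (\<psi> - m))" for \<psi>
  have p_upper: "p \<psi> \<le> N (\<psi> - m)" if "m \<in> D" for \<psi> m
    unfolding p_def by (rule cINF_lower) (use that N_nonneg in \<open>auto intro!: bdd_belowI2\<close>)
  have p_glb: "c \<le> p \<psi>" if "\<And>m. m \<in> D \<Longrightarrow> c \<le> N (\<psi> - m)" for c \<psi>
    unfolding p_def by (rule cINF_greatest) (use that D(2) in auto)
  have p_sub: "sublinear p"
  proof (rule sublinearI)
    fix \<phi> \<psi>
    have "p (\<phi> + \<psi>) - N (\<phi> - m) \<le> N (\<psi> - n)" if "m \<in> D" "n \<in> D" for m n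
      using p_upper[OF D(3)[rule_format, OF that], of "\<phi> + \<psi>"] N_add[of "\<phi> - m" "\<psi> - n"]
      by (simp add: algebra_simps)
    then have "p (\<phi> + \<psi>) - N (\<phi> - m) \<le> p \<psi>" if "m \<in> D" for m
      using that by (intro p_glb) auto
    then have "p (\<phi> + \<psi>) - p \<psi> \<le> p \<phi>"
      by (intro p_glb) (auto simp: algebra_simps)
    then show "p (\<phi> + \<psi>) \<le> p \<phi> + p \<psi>" by simp
  next
    fix t :: real and \<psi> assume t: "t > 0"
    have "p (t *\<^sub>R \<psi>) / t \<le> N (\<psi> - m)" if m: "m \<in> D" for m
    proof -
      have "p (t *\<^sub>R \<psi>) \<le> t * N (\<psi> - m)"
      proof (rule field_le_epsilon)
        fix e :: real assume e: "e > 0"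
        \<comment> \<open>\<open>D\<close> is closed under rational multiples only, so
          \<open>t\<close> is replaced by a rational \<open>r\<close> just below it. The summand 1
          covers the case \<open>N m = 0\<close>.\<close>
        define d where "d = e / (N m + 1)"
        have "d > 0" using e N_nonneg[of m] by (simp add: d_def)
        then obtain r where r: "r \<in> \<rat>" "t - d < r" "r < t"
          using Rats_dense_in_real[of "t - d" t] by auto
        have "p (t *\<^sub>R \<psi>) \<le> N (t *\<^sub>R (\<psi> - m) + (t - r) *\<^sub>R m)"
          using p_upper[OF D(4)[rule_format, OF r(1) m], of "t *\<^sub>R \<psi>"] by (simp add: algebra_simps)
        also have "\<dots> \<le> t * N (\<psi> - m) + (t - r) * N m"
          using N_add[of "t *\<^sub>R (\<psi> - m)" "(t - r) *\<^sub>R m"] N_scale[of t "\<psi> - m"]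
            N_scale[of "t - r" m] t r by simp
        also have "(t - r) * N m \<le> d * (N m + 1)"
          using r N_nonneg[of m] \<open>d > 0\<close> by (intro mult_mono) auto
        also have "\<dots> = e" using N_nonneg[of m] by (simp add: d_def)
        finally show "p (t *\<^sub>R \<psi>) \<le> t * N (\<psi> - m) + e" by simp
      qed
      then show ?thesis using t by (simp add: field_simps)
    qed
    then have "p (t *\<^sub>R \<psi>) / t \<le> p \<psi>" by (rule p_glb)
    then show "p (t *\<^sub>R \<psi>) \<le> t * p \<psi>" using t by (simp add: field_simps)
  qed
  have p_N: "p \<psi> \<le> N \<psi>" for \<psi> using p_upper[of 0 \<psi>] D(2) by simp
  have p_norm: "p \<psi> \<le> 1 * norm \<psi>" for \<psi>
    using p_N[of \<psi>] N_norm[of \<psi>] by linarith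
  have p_D: "p m \<le> 0" if "m \<in> D" for m
    using p_upper[OF that, of m] N_norm[of 0] by simp
  have p_nonpos: "p \<phi> \<le> 0" for \<phi>
  proof (rule ccontr)
    assume pos: "\<not> p \<phi> \<le> 0"
    obtain \<Phi> :: "('a \<Rightarrow>\<^sub>L real) \<Rightarrow>\<^sub>L real"
      where \<Phi>: "\<And>\<psi>. blinfun_apply \<Phi> \<psi> \<le> p \<psi>" "blinfun_apply \<Phi> \<phi> = p \<phi>"
      using Hahn_Banach_supporting_blinfun[OF p_sub p_norm, of \<phi>] by blast
    obtain x where x: "\<And>\<psi>. blinfun_apply \<Phi> \<psi> = blinfun_apply \<psi> x"
      using refl unfolding reflexive_space_def by blast
    have "x \<noteq> 0" using x[of \<phi>] \<Phi>(2) pos by auto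
    \<comment> \<open>A functional \<open>\<psi>\<close> that vanishes on \<open>Y\<close> and takes
      the value \<open>infdist x Y\<close> at \<open>x\<close> has \<open>N \<psi> \<le> 0\<close>.
      As evaluation at \<open>x\<close> is below \<open>p\<close>, that distance is at most
      0.\<close>
    have "x \<in> Y"
    proof -
      have le: "infdist b Y \<le> 1 * norm b" for b
        using infdist_le[OF Y0, of b] by simp
      obtain \<psi> :: "'a \<Rightarrow>\<^sub>L real" where \<psi>: "\<And>b. blinfun_apply \<psi> b \<le> infdist b Y"
          "blinfun_apply \<psi> x = infdist x Y"
        using Hahn_Banach_supporting_blinfun[OF sublinear_infdist[OF Y(1)] le, of x] by blast
      have "\<bar>blinfun_apply \<psi> y\<bar> \<le> 0" if "y \<in> Y" for y
        using \<psi>(1)[of y] \<psi>(1)[of "- y"] that subspace_neg[OF Y(1) that]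
        by (simp add: blinfun.minus_right)
      then have "N \<psi> \<le> 0" by (intro N_least) auto
      then have "infdist x Y \<le> 0" using \<Phi>(1)[of \<psi>] x[of \<psi>] p_N[of \<psi>] \<psi>(2) by simp
      then show ?thesis
        using in_closed_iff_infdist_zero[OF Y(2), of x] Y0 infdist_nonneg[of x Y] by fastforce
    qed
    \<comment> \<open>As \<open>F q\<close> norms \<open>q\<close>, its value at \<open>x\<close> is
      at least \<open>norm x - 2 * norm (x - q)\<close>, which is positive here, whereas
      \<open>\<Phi>\<close> is nonpositive on \<open>D\<close>.\<close>
    then obtain q where q: "q \<in> Q" "dist q x < norm x / 3"
      using Q(2) \<open>x \<noteq> 0\<close> closure_approachable[of x Q] by (metis subsetD zero_less_divide_iff zero_less_norm_iff zero_less_numeral)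
    have "blinfun_apply (F q) x = norm q + blinfun_apply (F q) (x - q)"
      using F(2)[of q] by (simp add: blinfun.diff_right)
    moreover have "\<bar>blinfun_apply (F q) (x - q)\<bar> \<le> norm (x - q)"
      using norm_blinfun[of "F q" "x - q"] mult_right_mono[OF F(1)[of q], of "norm (x - q)"] by simp
    moreover have "norm x \<le> norm q + norm (x - q)" by (metis norm_triangle_sub)
    moreover have "blinfun_apply (F q) x \<le> 0"
      using \<Phi>(1)[of "F q"] x[of "F q"] p_D[of "F q"] D(2) q(1) by auto
    moreover have "norm (x - q) < norm x / 3" using q(2) by (simp add: dist_norm norm_minus_commute)
    moreover have "norm x > 0" using \<open>x \<noteq> 0\<close> by simp
    ultimately show False by linarith
  qed
  show ?thesis
  proof
    show "countable D" by fact
    fix \<phi> and e :: real assume e: "e > 0"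
    have "\<exists>m\<in>D. N (\<phi> - m) < e"
      using p_glb[of e \<phi>] p_nonpos[of \<phi>] e by force
    then obtain m where m: "m \<in> D" "N (\<phi> - m) < e" by blast
    have "\<bar>blinfun_apply \<phi> y - blinfun_apply m y\<bar> \<le> e * norm y" if "y \<in> Y" for y
      using N_apply[OF that, of "\<phi> - m"] m(2) mult_right_mono[of "N (\<phi> - m)" e "norm y"]
      by (simp add: blinfun.diff_left)
    with m show "\<exists>\<psi>\<in>D. \<forall>y\<in>Y. \<bar>blinfun_apply \<phi> y - blinfun_apply \<psi> y\<bar> \<le> e * norm y" by blast
  qed
qed

section \<open>Baire category and approximate smoothness\<close>

lemma Baire_cover:
  fixes Y :: "'a::complete_space set"
  assumes Y: "closed Y" "Y \<noteq> {}" and I: "countable I"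
    and A: "\<And>i. i \<in> I \<Longrightarrow> A i \<subseteq> Y" "Y \<subseteq> (\<Union>i\<in>I. A i)"
  obtains i a r where "i \<in> I" "a \<in> Y" "r > 0" "ball a r \<inter> Y \<subseteq> closure (A i)"
proof -
  let ?X = "top_of_set Y"
  have cm: "completely_metrizable_space ?X"
    using Y(1) by (simp add: completely_metrizable_space_closedin completely_metrizable_space_euclidean)
  have sub: "closure (A i) \<subseteq> Y" if "i \<in> I" for i
    using A(1)[OF that] Y(1) by (rule closure_minimal)
  have "\<exists>i\<in>I. ?X interior_of (closure (A i)) \<noteq> {}"
  proof (rule ccontr)
    assume "\<not> ?thesis"
    then have "?X interior_of (\<Union>i\<in>I. closure (A i)) = {}"
      using cm I sub by (intro Baire_category_alt) (auto intro!: closed_subset)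
    moreover have "(\<Union>i\<in>I. closure (A i)) = topspace ?X"
    proof (rule antisym)
      show "(\<Union>i\<in>I. closure (A i)) \<subseteq> topspace ?X" using sub by auto
      have "(\<Union>i\<in>I. A i) \<subseteq> (\<Union>i\<in>I. closure (A i))"
        by (rule UN_mono) (simp_all add: closure_subset)
      with A(2) show "topspace ?X \<subseteq> (\<Union>i\<in>I. closure (A i))" by simp
    qed
    ultimately have "?X interior_of (topspace ?X) = {}" by simp
    then show False using Y(2) by (simp only: interior_of_topspace) simp
  qed
  then obtain i a where ia: "i \<in> I" "a \<in> ?X interior_of (closure (A i))" by blast
  then obtain T where T: "openin ?X T" "a \<in> T" "T \<subseteq> closure (A i)"
    unfolding interior_of_def by blast
  then obtain r where "r > 0" "ball a r \<inter> Y \<subseteq> T"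
    using openin_contains_ball[of Y T] by blast
  show ?thesis
  proof
    show "ball a r \<inter> Y \<subseteq> closure (A i)" using \<open>ball a r \<inter> Y \<subseteq> T\<close> T(3) by blast
    show "a \<in> Y" using openin_imp_subset[OF T(1)] T(2) by blast
  qed fact+
qed

text \<open>The sets of points having a subgradient close to a given member of a countable dense
  set of functionals cover a separable subspace; where one of these sets is dense, the
  convex function \<open>s\<close> is squeezed between two nearly equal affine functions.\<close>

lemma sublinear_eps_smooth_point:
  fixes s :: "'a::banach \<Rightarrow> real"
  assumes refl: "reflexive_space TYPE('a)"
    and s: "sublinear s" "\<And>x. s x \<le> L * norm x" and e: "e > 0"
  shows "\<exists>a. \<exists>\<theta>>0. \<forall>h. norm h \<le> \<theta> \<longrightarrow> s (a + h) + s (a - h) - 2 * s a \<le> e * norm h"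
proof (rule ccontr)
  assume "\<not> ?thesis"
  then have rough: "\<exists>h. norm h \<le> \<theta> \<and> \<not> s (a + h) + s (a - h) - 2 * s a \<le> e * norm h"
    if "\<theta> > 0" for a \<theta>
    using that by blast
  \<comment> \<open>Rough directions are chosen at every point and every scale. Closing a countable
    set under \<open>g\<close> makes the roughness survive in a separable subspace.\<close>
  define g where "g a n = (SOME h. norm h \<le> 1 / Suc n \<and>
    \<not> s (a + h) + s (a - h) - 2 * s a \<le> e * norm h)" for a and n :: nat
  have "norm (g a n) \<le> 1 / Suc n \<and>
      \<not> s (a + g a n) + s (a - g a n) - 2 * s a \<le> e * norm (g a n)" for a n
    unfolding g_def by (rule someI_ex) (rule rough, simp)
  then have g: "norm (g a n) \<le> 1 / Suc n"
      "s (a + g a n) + s (a - g a n) - 2 * s a > e * norm (g a n)" for a n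
    by (auto simp: not_le)
  have "countable {0 :: 'a}" by simp
  then obtain Q where Q: "countable Q" "{0} \<subseteq> Q" "\<forall>x\<in>Q. \<forall>y\<in>Q. x + y \<in> Q"
    "\<forall>r\<in>\<rat>. \<forall>x\<in>Q. r *\<^sub>R x \<in> Q" "\<forall>x\<in>Q. \<forall>n. g x n \<in> Q"
    by (elim countable_rational_closure[of "{0}" g, THEN exE] conjE) (rule that)
  define Y where "Y = closure Q"
  have QY: "Q \<subseteq> Y" by (simp add: Y_def closure_subset)
  have Y_add: "x + y \<in> Y" if xy: "x \<in> Y" "y \<in> Y" for x y
  proof -
    obtain X where X: "\<And>n. X n \<in> Q" "X \<longlonglongrightarrow> x"
      using xy(1) unfolding Y_def closure_sequential by blast
    obtain Z where Z: "\<And>n. Z n \<in> Q" "Z \<longlonglongrightarrow> y"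
      using xy(2) unfolding Y_def closure_sequential by blast
    have "(\<lambda>n. X n + Z n) \<longlonglongrightarrow> x + y" "\<And>n. X n + Z n \<in> Q"
      using X Z Q(3) by (auto intro: tendsto_add)
    then show ?thesis unfolding Y_def closure_sequential by (intro exI[of _ "\<lambda>n. X n + Z n"]) auto
  qed
  have Y_scale: "t *\<^sub>R x \<in> Y" if x: "x \<in> Y" for t x
  proof -
    obtain X where X: "\<And>n. X n \<in> Q" "X \<longlonglongrightarrow> x"
      using x unfolding Y_def closure_sequential by blast
    have "t \<in> closure \<rat>" by (simp add: Rats_closure_real)
    then obtain R :: "nat \<Rightarrow> real" where R: "\<And>n. R n \<in> \<rat>" "R \<longlonglongrightarrow> t"
      unfolding closure_sequential by blast
    have "(\<lambda>n. R n *\<^sub>R X n) \<longlonglongrightarrow> t *\<^sub>R x" "\<And>n. R n *\<^sub>R X n \<in> Q"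
      using X R Q(4) by (auto intro: tendsto_scaleR)
    then show ?thesis unfolding Y_def closure_sequential by (intro exI[of _ "\<lambda>n. R n *\<^sub>R X n"]) auto
  qed
  have Y: "subspace Y" "closed Y"
    using QY Q(2) Y_add Y_scale by (auto simp: subspace_def) (simp add: Y_def)
  obtain D :: "('a \<Rightarrow>\<^sub>L real) set" where D: "countable D"
    "\<And>\<phi> e. e > 0 \<Longrightarrow> \<exists>\<psi>\<in>D. \<forall>y\<in>Y. \<bar>blinfun_apply \<phi> y - blinfun_apply \<psi> y\<bar> \<le> e * norm y"
    using reflexive_separable_dual[OF refl Y Q(1)] by (auto simp: Y_def)
  \<comment> \<open>The tolerance is \<open>e / 2\<close> because two one-sided estimates with the
    same \<open>\<psi>\<close> will be added.\<close>
  define A where "A \<psi> = {a \<in> Y. \<exists>\<phi> :: 'a \<Rightarrow>\<^sub>L real. (\<forall>b. blinfun_apply \<phi> b \<le> s b) \<and> blinfun_apply \<phi> a = s a \<and>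
      (\<forall>y\<in>Y. \<bar>blinfun_apply \<phi> y - blinfun_apply \<psi> y\<bar> \<le> e / 2 * norm y)}" for \<psi> :: "'a \<Rightarrow>\<^sub>L real"
  have "Y \<subseteq> (\<Union>\<psi>\<in>D. A \<psi>)"
  proof
    fix a assume "a \<in> Y"
    obtain \<phi> :: "'a \<Rightarrow>\<^sub>L real" where \<phi>: "\<And>b. blinfun_apply \<phi> b \<le> s b" "blinfun_apply \<phi> a = s a"
      using Hahn_Banach_supporting_blinfun[OF s, of a] by blast
    obtain \<psi> where "\<psi> \<in> D" "\<forall>y\<in>Y. \<bar>blinfun_apply \<phi> y - blinfun_apply \<psi> y\<bar> \<le> e / 2 * norm y"
      using D(2)[of "e / 2" \<phi>] e by auto
    with \<phi> \<open>a \<in> Y\<close> show "a \<in> (\<Union>\<psi>\<in>D. A \<psi>)" by (auto simp: A_def)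
  qed
  moreover have "Y \<noteq> {}" "\<And>\<psi>. A \<psi> \<subseteq> Y" using Q(2) QY by (auto simp: A_def)
  ultimately obtain \<psi> a0 r where *: "a0 \<in> Y" "r > 0" "ball a0 r \<inter> Y \<subseteq> closure (A \<psi>)"
    using Baire_cover[OF Y(2) _ D(1), of A] by metis
  have L: "\<bar>s x - s y\<bar> \<le> L * norm (x - y)" for x y
    using sublinear_add[OF s(1), of y "x - y"] sublinear_add[OF s(1), of x "y - x"]
      s(2)[of "x - y"] s(2)[of "y - x"] by (simp add: norm_minus_commute abs_le_iff)
  have cont: "(\<lambda>n. s (X n)) \<longlonglongrightarrow> s x" if "X \<longlonglongrightarrow> x" for X x
  proof (rule Lim_null_comparison[where g = "\<lambda>n. L * norm (X n - x)", THEN LIM_zero_cancel])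
    show "\<forall>\<^sub>F n in sequentially. norm (s (X n) - s x) \<le> L * norm (X n - x)" using L by simp
    show "(\<lambda>n. L * norm (X n - x)) \<longlonglongrightarrow> 0"
      using that by (auto intro!: tendsto_mult_right_zero tendsto_norm_zero LIM_zero)
  qed
  \<comment> \<open>At a member of \<open>A \<psi>\<close> the supporting functional bounds the
    increment of \<open>s\<close>; replacing it by \<open>\<psi>\<close> costs \<open>e / 2\<close>.
    Density of \<open>A \<psi>\<close> and continuity of \<open>s\<close> extend the estimate to the
    relative ball.\<close>
  have squeeze: "s c - s b \<le> blinfun_apply \<psi> (c - b) + e / 2 * norm (c - b)"
    if "c \<in> ball a0 r \<inter> Y" "b \<in> Y" for c b
  proof -
    have "c \<in> closure (A \<psi>)" using * that by blast
    then obtain X where X: "\<And>n. X n \<in> A \<psi>" "X \<longlonglongrightarrow> c" unfolding closure_sequential by blast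
    have ineq: "s (X n) - s b \<le> blinfun_apply \<psi> (X n - b) + e / 2 * norm (X n - b)" for n
    proof -
      obtain \<phi> :: "'a \<Rightarrow>\<^sub>L real" where \<phi>: "\<forall>b. blinfun_apply \<phi> b \<le> s b" "blinfun_apply \<phi> (X n) = s (X n)"
          "\<forall>y\<in>Y. \<bar>blinfun_apply \<phi> y - blinfun_apply \<psi> y\<bar> \<le> e / 2 * norm y" and "X n \<in> Y"
        using X(1)[of n] by (auto simp: A_def)
      have "X n - b \<in> Y" using \<open>X n \<in> Y\<close> that Y(1) by (intro subspace_diff) auto
      then have "\<bar>blinfun_apply \<phi> (X n - b) - blinfun_apply \<psi> (X n - b)\<bar> \<le> e / 2 * norm (X n - b)"
        using \<phi>(3) by blast
      moreover have "s (X n) - s b \<le> blinfun_apply \<phi> (X n - b)"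
        using \<phi>(1)[rule_format, of b] \<phi>(2) by (simp add: blinfun.diff_right)
      ultimately show ?thesis by linarith
    qed
    show ?thesis
    proof (rule LIMSEQ_le)
      show "(\<lambda>n. s (X n) - s b) \<longlonglongrightarrow> s c - s b"
        using cont[OF X(2)] by (intro tendsto_intros)
      show "(\<lambda>n. blinfun_apply \<psi> (X n - b) + e / 2 * norm (X n - b))
          \<longlonglongrightarrow> blinfun_apply \<psi> (c - b) + e / 2 * norm (c - b)"
        using X(2) by (intro tendsto_intros)
    qed (use ineq in auto)
  qed
  \<comment> \<open>The centre is taken in \<open>Q\<close>, not merely in \<open>Y\<close>, so that
    its rough direction \<open>g a n\<close> also lies in \<open>Y\<close>. Large \<open>n\<close>
    keeps \<open>a + h\<close> and \<open>a - h\<close> in the ball; on adding the two squeezes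
    \<open>\<psi>\<close> cancels.\<close>
  obtain a where a: "a \<in> Q" "dist a a0 < r"
    using *(1,2) unfolding Y_def closure_approachable by blast
  obtain n where n: "inverse (real (Suc n)) < r - dist a a0"
    using reals_Archimedean[of "r - dist a a0"] a(2) by auto
  define h where "h = g a n"
  have nh: "norm h < r - dist a a0" 
    using g(1)[of a n] n unfolding h_def inverse_eq_divide by linarith
  have "a \<in> Y" "h \<in> Y" using a(1) Q(5) QY by (auto simp: h_def)
  then have inY: "a + h \<in> Y" "a - h \<in> Y" using Y(1) by (auto intro: subspace_add subspace_diff)
  have "dist (a + h) a \<le> norm h" "dist (a - h) a \<le> norm h" by (simp_all add: dist_norm)
  then have "a + h \<in> ball a0 r" "a - h \<in> ball a0 r"
    using nh dist_triangle[of "a + h" a0 a] dist_triangle[of "a - h" a0 a]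
    by (simp_all add: dist_commute)
  then have "s (a + h) - s a \<le> blinfun_apply \<psi> h + e / 2 * norm h"
      "s (a - h) - s a \<le> - blinfun_apply \<psi> h + e / 2 * norm h"
    using squeeze[of "a + h" a] squeeze[of "a - h" a] inY \<open>a \<in> Y\<close> by (auto simp: blinfun.minus_right)
  then show False using g(2)[of a n] by (simp add: h_def)
qed

section \<open>Approximate subgradients of Lipschitz functions\<close>

text \<open>Among equal pieces of a segment one rises at least at the average rate, and convexity of
  the ball keeps the pieces inside. Steps can thus be shortened at will without losing
  slope.\<close>

lemma chop_increment:
  fixes F :: "'a::real_normed_vector \<Rightarrow> real"
  assumes \<eta>: "dist c \<eta> \<le> R" "dist c (\<eta> + r *\<^sub>R a) \<le> R" and r: "r > 0"
    and q: "F (\<eta> + r *\<^sub>R a) - F \<eta> > q * r" and d: "d > 0"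
  shows "\<exists>\<eta>' r'. 0 < r' \<and> r' < d \<and> dist c \<eta>' \<le> R \<and> dist c (\<eta>' + r' *\<^sub>R a) \<le> R \<and>
    F (\<eta>' + r' *\<^sub>R a) - F \<eta>' > q * r'"
proof -
  obtain n where n: "r / d < real n" using reals_Archimedean2 by blast
  have "0 < r / d" using r d by simp
  with n have n0: "0 < real n" by linarith
  then have npos: "0 < n" by simp
  define r' where "r' = r / real n"
  have r': "0 < r'" "r' < d" "real n * r' = r"
    using r d n n0 by (auto simp: r'_def field_simps)
  define X where "X j = \<eta> + (real j * r') *\<^sub>R a" for j :: nat
  have X: "dist c (X j) \<le> R" if "j \<le> n" for j
  proof -
    define t where "t = real j / real n"
    have t: "0 \<le> t" "t \<le> 1" "real j * r' = t * r" using that n0 by (auto simp: t_def r'_def)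
    have "(1 - t) *\<^sub>R \<eta> + t *\<^sub>R (\<eta> + r *\<^sub>R a) \<in> cball c R"
      using \<eta> t by (intro convexD[OF convex_cball]) auto
    moreover have "(1 - t) *\<^sub>R \<eta> + t *\<^sub>R (\<eta> + r *\<^sub>R a) = X j"
      using t(3) by (simp add: X_def algebra_simps)
    ultimately show ?thesis by simp
  qed
  have "\<exists>j<n. F (X (Suc j)) - F (X j) > q * r'"
  proof (rule ccontr)
    assume "\<not> ?thesis"
    then have "(\<Sum>j<n. F (X (Suc j)) - F (X j)) \<le> (\<Sum>j<n. q * r')"
      by (intro sum_mono) (meson lessThan_iff not_le)
    then have "F (X n) - F (X 0) \<le> q * (real n * r')"
      using sum_lessThan_telescope[of "\<lambda>j. F (X j)" n] by (simp add: algebra_simps)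
    then show False using q r'(3) by (simp add: X_def)
  qed
  then obtain j where j: "j < n" "F (X (Suc j)) - F (X j) > q * r'" by blast
  have "X (Suc j) = X j + r' *\<^sub>R a" by (simp add: X_def algebra_simps)
  then show ?thesis
    using j r' X[of j] X[of "Suc j"] by (intro exI[of _ "X j"] exI[of _ r']) simp
qed

text \<open>The supremum of the difference quotients of \<open>F\<close> over a ball is sublinear in the direction.
  A point and a direction nearly attaining it, where the direction is a point of approximate
  smoothness of that sublinear functional, yield the approximate subgradient.\<close>

lemma approximate_subgradient:
  fixes F :: "'a::banach \<Rightarrow> real"
  assumes refl: "reflexive_space TYPE('a)"
    and R: "R > 0" and L: "L \<ge> 0"
    and lip: "\<And>x y. x \<in> ball c R \<Longrightarrow> y \<in> ball c R \<Longrightarrow> F x - F y \<le> L * norm (x - y)"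
    and e: "e > 0" and \<tau>0: "\<tau>0 > 0"
  shows "\<exists>\<eta> (\<phi> :: 'a \<Rightarrow>\<^sub>L real) \<tau>. \<eta> \<in> ball c R \<and> 0 < \<tau> \<and> \<tau> < \<tau>0 \<and>
    (\<forall>k. norm k \<le> \<tau> \<longrightarrow> F (\<eta> + k) \<ge> F \<eta> + blinfun_apply \<phi> k - e * \<tau>)"
proof -
  define I where "I a = {(\<eta>, r). r > 0 \<and> \<eta> \<in> ball c R \<and> \<eta> + r *\<^sub>R a \<in> ball c R}" for a :: 'a
  define quot where "quot a = (\<lambda>(\<eta>, r). (F (\<eta> + r *\<^sub>R a) - F \<eta>) / r)" for a
  define s where "s a = (SUP z\<in>I a. quot a z)" for a
  have quot_le: "quot a z \<le> L * norm a" if "z \<in> I a" for a z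
  proof -
    obtain \<eta> r where "z = (\<eta>, r)" by (cases z)
    with that have z: "z = (\<eta>, r)" "r > 0" "\<eta> \<in> ball c R" "\<eta> + r *\<^sub>R a \<in> ball c R"
      by (auto simp: I_def)
    then have "F (\<eta> + r *\<^sub>R a) - F \<eta> \<le> L * (r * norm a)" using lip[of "\<eta> + r *\<^sub>R a" \<eta>] by simp
    then show ?thesis using z by (simp add: quot_def field_simps)
  qed
  have bdd: "bdd_above (quot a ` I a)" for a
    by (rule bdd_aboveI2[where M = "L * norm a"]) (rule quot_le)
  have ne: "I a \<noteq> {}" for a
  proof -
    have pos: "0 < 2 * (norm a + 1)" by (simp add: add_nonneg_pos)
    have "norm a < 2 * (norm a + 1)" using norm_ge_zero[of a] by (simp add: add_nonneg_pos)
    then have "R * norm a < R * (2 * (norm a + 1))"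
      using R by (rule mult_strict_left_mono)
    then have "norm ((R / (2 * (norm a + 1))) *\<^sub>R a) < R"
      using R pos by (simp add: field_simps)
    then have "(c, R / (2 * (norm a + 1))) \<in> I a"
      using R pos by (simp add: I_def dist_norm)
    then show ?thesis by blast
  qed
  have s_upper: "F (\<eta> + r *\<^sub>R a) - F \<eta> \<le> s a * r"
    if "r > 0" "\<eta> \<in> ball c R" "\<eta> + r *\<^sub>R a \<in> ball c R" for \<eta> r a
  proof -
    have "quot a (\<eta>, r) \<le> s a"
      unfolding s_def by (rule cSUP_upper) (use that bdd in \<open>auto simp: I_def\<close>)
    then show ?thesis using that by (simp add: quot_def field_simps)
  qed
  \<comment> \<open>A radius \<open>R'\<close> strictly below \<open>R\<close> is recorded to leave
    room for perturbing the points; chopping preserves it.\<close>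
  have s_near: "\<exists>\<eta> r R'. r > 0 \<and> R' < R \<and> dist c \<eta> \<le> R' \<and> dist c (\<eta> + r *\<^sub>R a) \<le> R' \<and>
      F (\<eta> + r *\<^sub>R a) - F \<eta> > q * r" if "q < s a" for q a
  proof -
    have "\<exists>z\<in>I a. q < quot a z"
      using that less_cSUP_iff[OF ne bdd, of q a] by (simp add: s_def)
    then obtain z where "z \<in> I a" "q < quot a z" ..
    moreover obtain \<eta> r where "z = (\<eta>, r)" by (cases z)
    ultimately have *: "r > 0" "dist c \<eta> < R" "dist c (\<eta> + r *\<^sub>R a) < R" "q < quot a (\<eta>, r)"
      by (auto simp: I_def)
    have "q * r < F (\<eta> + r *\<^sub>R a) - F \<eta>"
      using *(1,4) by (simp add: quot_def pos_less_divide_eq)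
    moreover have "max (dist c \<eta>) (dist c (\<eta> + r *\<^sub>R a)) < R" using *(2,3) by simp
    ultimately show ?thesis using *(1) by (meson max.cobounded1 max.cobounded2)
  qed
  have s_sub: "sublinear s"
  proof (rule sublinearI)
    fix a b
    show "s (a + b) \<le> s a + s b"
    proof (rule ccontr)
      assume "\<not> ?thesis"
      then obtain \<eta> r R' where 1: "r > 0" "R' < R" "dist c \<eta> \<le> R'" "dist c (\<eta> + r *\<^sub>R (a + b)) \<le> R'"
          "F (\<eta> + r *\<^sub>R (a + b)) - F \<eta> > (s a + s b) * r"
        using s_near[of "s a + s b" "a + b"] by auto
      have na: "0 < norm a + 1" by (simp add: add_nonneg_pos)
      then have "(R - R') / (norm a + 1) > 0" using 1(2) by simp
      \<comment> \<open>The step is so short that the intermediate point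
        \<open>\<eta>' + r' *\<^sub>R a\<close> stays in the ball; the increment along
        \<open>a + b\<close> then splits there.\<close>
      then obtain \<eta>' r' where 2: "0 < r'" "r' < (R - R') / (norm a + 1)" "dist c \<eta>' \<le> R'"
          "dist c (\<eta>' + r' *\<^sub>R (a + b)) \<le> R'" "F (\<eta>' + r' *\<^sub>R (a + b)) - F \<eta>' > (s a + s b) * r'"
        using chop_increment[OF 1(3,4,1,5)] by blast
      have "r' * (norm a + 1) < R - R'" using 2(2) na by (simp add: field_simps)
      then have "r' * norm a < R - R'" using 2(1) by (simp add: algebra_simps)
      moreover have "dist c (\<eta>' + r' *\<^sub>R a) \<le> dist c \<eta>' + r' * norm a"
        using dist_triangle[of c "\<eta>' + r' *\<^sub>R a" \<eta>'] 2(1) by (simp add: dist_norm)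
      ultimately have in_ball: "\<eta>' + r' *\<^sub>R a \<in> ball c R" using 2(3) by simp
      have "F (\<eta>' + r' *\<^sub>R a) - F \<eta>' \<le> s a * r'"
        using 1(2) 2 in_ball by (intro s_upper) auto
      moreover have "F (\<eta>' + r' *\<^sub>R a + r' *\<^sub>R b) - F (\<eta>' + r' *\<^sub>R a) \<le> s b * r'"
        using 1(2) 2 in_ball by (intro s_upper) (auto simp: algebra_simps)
      ultimately show False using 2(5) by (simp add: algebra_simps)
    qed
  next
    fix t :: real and a assume t: "t > 0"
    show "s (t *\<^sub>R a) \<le> t * s a"
    proof (rule ccontr)
      assume "\<not> ?thesis"
      then obtain \<eta> r R' where "r > 0" "R' < R" "dist c \<eta> \<le> R'" "dist c (\<eta> + r *\<^sub>R (t *\<^sub>R a)) \<le> R'"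
          "F (\<eta> + r *\<^sub>R (t *\<^sub>R a)) - F \<eta> > t * s a * r"
        using s_near[of "t * s a" "t *\<^sub>R a"] by auto
      then show False using s_upper[of "r * t" \<eta> a] t by (simp add: algebra_simps)
    qed
  qed
  have s_norm: "s a \<le> L * norm a" for a
    unfolding s_def by (rule cSUP_least[OF ne quot_le])
  obtain a \<theta> where \<theta>: "\<theta> > 0"
    and smooth: "\<And>h. norm h \<le> \<theta> \<Longrightarrow> s (a + h) + s (a - h) - 2 * s a \<le> e / 2 * norm h"
    using sublinear_eps_smooth_point[OF refl s_sub s_norm, of "e / 2"] e by auto
  obtain \<phi> :: "'a \<Rightarrow>\<^sub>L real" where \<phi>: "\<And>x. blinfun_apply \<phi> x \<le> s x" "blinfun_apply \<phi> a = s a"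
    using Hahn_Banach_supporting_blinfun[OF s_sub s_norm, of a] by blast
  \<comment> \<open>The error \<open>e * \<theta>\<close> per unit of step is halved: one half for
    missing the supremum, the other for the failure of exact smoothness within
    \<open>\<theta>\<close>.\<close>
  define q where "q = s a - e * \<theta> / 2"
  have "q < s a" using e \<theta> by (simp add: q_def)
  then obtain \<eta>1 r1 R' where 1: "r1 > 0" "R' < R" "dist c \<eta>1 \<le> R'" "dist c (\<eta>1 + r1 *\<^sub>R a) \<le> R'"
      "F (\<eta>1 + r1 *\<^sub>R a) - F \<eta>1 > q * r1"
    using s_near by blast
  \<comment> \<open>A step \<open>r\<close> turns the smoothness radius \<open>\<theta>\<close> into
    \<open>\<tau> = \<theta> * r\<close>; this bound puts \<open>\<tau>\<close> below both
    \<open>\<tau>0\<close> and the room \<open>R - R'\<close>.\<close>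
  define d where "d = min (R - R') \<tau>0 / \<theta>"
  have "d > 0" using 1(2) \<tau>0 \<theta> by (simp add: d_def)
  then obtain \<eta> r where 2: "0 < r" "r < d" "dist c \<eta> \<le> R'" "dist c (\<eta> + r *\<^sub>R a) \<le> R'"
      "F (\<eta> + r *\<^sub>R a) - F \<eta> > q * r"
    using chop_increment[OF 1(3,4,1,5)] by blast
  define \<tau> where "\<tau> = \<theta> * r"
  have \<tau>: "0 < \<tau>" "\<tau> < \<tau>0" "\<tau> < R - R'"
    using 2(1,2) \<theta> by (auto simp: \<tau>_def d_def field_simps)
  have "F (\<eta> + k) \<ge> F \<eta> + blinfun_apply \<phi> k - e * \<tau>" if k: "norm k \<le> \<tau>" for k
  proof -
    define h where "h = (1 / r) *\<^sub>R k"
    have kh: "k = r *\<^sub>R h" using 2(1) by (simp add: h_def)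
    have h: "norm h \<le> \<theta>" using k 2(1) by (simp add: h_def \<tau>_def field_simps)
    have "dist c (\<eta> + k) \<le> dist c \<eta> + norm k"
      using dist_triangle[of c "\<eta> + k" \<eta>] by (simp add: dist_norm)
    then have "\<eta> + k \<in> ball c R" using 2(3) k \<tau>(3) by simp
    \<comment> \<open>From \<open>\<eta> + k\<close> the step \<open>r *\<^sub>R (a - h)\<close>
      leads to the nearly optimal endpoint \<open>\<eta> + r *\<^sub>R a\<close>, so the upper bound
      on this increment is a lower bound on \<open>F (\<eta> + k)\<close>.\<close>
    then have "F (\<eta> + k + r *\<^sub>R (a - h)) - F (\<eta> + k) \<le> s (a - h) * r"
      using 2 1(2) by (intro s_upper) (auto simp: kh algebra_simps)
    moreover have "\<eta> + k + r *\<^sub>R (a - h) = \<eta> + r *\<^sub>R a" by (simp add: kh algebra_simps)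
    ultimately have "F (\<eta> + r *\<^sub>R a) - F (\<eta> + k) \<le> s (a - h) * r" by simp
    moreover have "s (a - h) \<le> s a - blinfun_apply \<phi> h + e / 2 * \<theta>"
    proof -
      have "e / 2 * norm h \<le> e / 2 * \<theta>" using h e by (intro mult_left_mono) auto
      then show ?thesis
        using smooth[OF h] \<phi>(1)[of "a + h"] \<phi>(2) blinfun.add_right[of \<phi> a h] by linarith
    qed
    then have "s (a - h) * r \<le> (s a - blinfun_apply \<phi> h + e / 2 * \<theta>) * r"
      using 2(1) by (intro mult_right_mono) auto
    moreover have "blinfun_apply \<phi> k = r * blinfun_apply \<phi> h" by (simp add: kh blinfun.scaleR_right)
    ultimately show ?thesis using 2(5) by (simp add: q_def \<tau>_def algebra_simps)
  qed
  then show ?thesis using 2(3) 1(2) \<tau>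
    by (intro exI[of _ \<eta>] exI[of _ \<phi>] exI[of _ \<tau>]) auto
qed

section \<open>Infimal convolution with a power of the norm\<close>

text \<open>\<open>E\<close> stands for the effective domain and \<open>g\<close> for the finite
  values there, which keeps the optimization within the reals.\<close>

locale power_inf_convolution =
  fixes E :: "'a::banach set" and g :: "'a \<Rightarrow> real" and c \<sigma> p :: real
  assumes nonempty: "E \<noteq> {}"
    and lower_bound: "\<And>x. x \<in> E \<Longrightarrow> c \<le> g x"
    and sigma_pos: "\<sigma> > 0" and p_ge: "p \<ge> 1"
begin

definition cost :: "real \<Rightarrow> real" where
  "cost t = \<sigma> * t powr p"

definition obj :: "'a \<Rightarrow> 'a \<Rightarrow> real" where
  "obj \<eta> w = g w + cost (norm (w - \<eta>))"

text \<open>The infimal convolution of the penalty with \<open>g\<close>, taken as infinite off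
  \<open>E\<close>; for \<open>p = 2\<close> a Moreau envelope.\<close>

definition env :: "'a \<Rightarrow> real" where
  "env \<eta> = (INF w\<in>E. obj \<eta> w)"

definition near :: "'a \<Rightarrow> real \<Rightarrow> 'a set" where
  "near \<eta> \<delta> = {w\<in>E. obj \<eta> w \<le> env \<eta> + \<delta>}"

lemma cost_nonneg: "cost t \<ge> 0"
  using sigma_pos by (simp add: cost_def)

lemma cost_mono: "0 \<le> s \<Longrightarrow> s \<le> t \<Longrightarrow> cost s \<le> cost t"
  using sigma_pos p_ge by (simp add: cost_def powr_mono2)

lemma cost_tendsto:
  assumes "(f \<longlongrightarrow> l) F" "\<And>i. f i \<ge> 0"
  shows "((\<lambda>i. cost (f i)) \<longlongrightarrow> cost l) F"
  unfolding cost_def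
  by (intro tendsto_mult_left tendsto_powr' assms tendsto_const) (use assms(2) p_ge in auto)

lemma cost_has_derivative:
  "t > 0 \<Longrightarrow> (cost has_real_derivative \<sigma> * (p * t powr (p - 1))) (at t)"
  unfolding cost_def by (intro DERIV_cmult has_real_derivative_powr)

text \<open>The derivative is nondecreasing because \<open>p \<ge> 1\<close>, so its value at
  \<open>R\<close> bounds it. The mean value theorem needs differentiability in the interior only,
  which admits \<open>d = 0\<close>.\<close>

lemma cost_step:
  assumes "0 \<le> d" "0 \<le> t" "d + t \<le> R"
  shows "cost (d + t) - cost d \<le> \<sigma> * (p * R powr (p - 1)) * t"
proof (cases "t = 0")
  case False
  with assms have t: "t > 0" by simp
  have "continuous_on {d..d + t} cost"
    unfolding cost_def using assms(1) p_ge
    by (intro continuous_on_mult_left continuous_on_powr' continuous_on_id continuous_on_const) auto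
  moreover have "cost differentiable (at x)" if "d < x" for x
    using cost_has_derivative[of x] that assms(1) by (auto simp: real_differentiable_def)
  ultimately obtain l z where z: "d < z" "z < d + t" "DERIV cost z :> l"
      "cost (d + t) - cost d = (d + t - d) * l"
    using MVT[of d "d + t" cost] t by auto
  have "l = \<sigma> * (p * z powr (p - 1))"
    using DERIV_unique[OF z(3) cost_has_derivative] z(1) assms(1) by simp
  also have "\<dots> \<le> \<sigma> * (p * R powr (p - 1))"
    using z assms p_ge sigma_pos by (intro mult_left_mono powr_mono2) auto
  finally show ?thesis using z(4) t by (simp add: mult.commute mult_left_mono)
qed simp

text \<open>This is convexity with value 0 at 0. It later bounds subgradients away from zero, so
  that they can be normalized.\<close>

lemma cost_radial:
  assumes "0 \<le> a" "a \<le> d" "d > 0"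
  shows "cost a \<le> a / d * cost d"
proof -
  have "a powr p = (a / d) powr p * d powr p"
    using assms powr_mult[of "a / d" d p] by simp
  also have "(a / d) powr p \<le> (a / d) powr 1"
    using assms p_ge by (intro powr_mono') auto
  finally have "a powr p \<le> a / d * d powr p"
    using assms by (simp add: mult_right_mono)
  then have "\<sigma> * a powr p \<le> \<sigma> * (a / d * d powr p)"
    using sigma_pos by (intro mult_left_mono) auto
  then show ?thesis by (simp add: cost_def mult_ac)
qed

text \<open>The derivative is uniformly continuous on compact intervals away from 0, and the second
  difference is \<open>\<tau>\<close> times a difference of derivatives at nearby points.\<close>

lemma cost_uniformly_smooth:
  assumes a: "a > 0" and e: "e > 0"
  obtains \<tau>0 where "\<tau>0 > 0"
    "\<And>d \<tau>. a \<le> d \<Longrightarrow> d \<le> R \<Longrightarrow> 0 < \<tau> \<Longrightarrow> \<tau> < \<tau>0 \<Longrightarrow>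
      \<tau> < a \<and> cost (d + \<tau>) + cost (d - \<tau>) - 2 * cost d \<le> e * \<tau>"
proof -
  let ?D = "\<lambda>t. \<sigma> * (p * t powr (p - 1))"
  have "continuous_on {a / 2..R + 1} ?D"
    using a by (intro continuous_intros) auto
  then have "uniformly_continuous_on {a / 2..R + 1} ?D"
    by (rule compact_uniformly_continuous) simp
  then obtain \<delta> where \<delta>: "\<delta> > 0" "\<And>x y. x \<in> {a / 2..R + 1} \<Longrightarrow> y \<in> {a / 2..R + 1} \<Longrightarrow>
      dist x y < \<delta> \<Longrightarrow> dist (?D x) (?D y) < e"
    using e unfolding uniformly_continuous_on_def by metis
  \<comment> \<open>The three bounds put the two mean value points closer than
    \<open>\<delta>\<close>, keep \<open>d - \<tau>\<close> above \<open>a / 2\<close>, and keep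
    \<open>d + \<tau>\<close> below \<open>R + 1\<close>.\<close>
  define \<tau>0 where "\<tau>0 = Min {\<delta> / 2, a / 2, 1}"
  have "\<tau>0 > 0" using \<delta>(1) a by (simp add: \<tau>0_def)
  moreover have "\<tau> < a \<and> cost (d + \<tau>) + cost (d - \<tau>) - 2 * cost d \<le> e * \<tau>"
    if d: "a \<le> d" "d \<le> R" and \<tau>: "0 < \<tau>" "\<tau> < \<tau>0" for d \<tau>
  proof -
    have \<tau>': "\<tau> < \<delta> / 2" "\<tau> < a / 2" "\<tau> < 1" using \<tau>(2) by (auto simp: \<tau>0_def)
    obtain x where x: "d < x" "x < d + \<tau>" "cost (d + \<tau>) - cost d = (d + \<tau> - d) * ?D x"
      using MVT2[of d "d + \<tau>" cost ?D] \<tau>(1) d a cost_has_derivative by fastforce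
    have "0 < d - \<tau>" using d \<tau>' a by linarith
    then obtain y where y: "d - \<tau> < y" "y < d" "cost d - cost (d - \<tau>) = (d - (d - \<tau>)) * ?D y"
      using MVT2[of "d - \<tau>" d cost ?D] \<tau>(1) cost_has_derivative by fastforce
    have "dist (?D x) (?D y) < e"
      using x y d \<tau>' by (intro \<delta>(2)) (auto simp: dist_real_def)
    then have "?D x - ?D y \<le> e" by (simp add: dist_real_def abs_less_iff)
    then have "\<tau> * (?D x - ?D y) \<le> \<tau> * e" using \<tau>(1) by (intro mult_left_mono) auto
    moreover have "cost (d + \<tau>) + cost (d - \<tau>) - 2 * cost d = \<tau> * (?D x - ?D y)"
      using x(3) y(3) by (simp add: right_diff_distrib)
    ultimately show ?thesis using \<tau>' a by (simp add: mult.commute)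
  qed
  ultimately show ?thesis using that by blast
qed

lemma obj_lower: "w \<in> E \<Longrightarrow> c \<le> obj \<eta> w"
  using lower_bound[of w] cost_nonneg[of "norm (w - \<eta>)"] by (simp add: obj_def)

lemma env_le: "w \<in> E \<Longrightarrow> env \<eta> \<le> obj \<eta> w"
  unfolding env_def by (rule cINF_lower) (auto intro!: bdd_belowI2 obj_lower)

lemma near_mono: "w \<in> near \<eta> \<delta> \<Longrightarrow> \<delta> \<le> \<delta>' \<Longrightarrow> w \<in> near \<eta> \<delta>'"
  by (auto simp: near_def)

lemma near_nonempty:
  assumes "\<delta> > 0"
  shows "\<exists>w. w \<in> near \<eta> \<delta>"
proof -
  have "bdd_below (obj \<eta> ` E)" by (auto intro!: bdd_belowI2 obj_lower)
  moreover have "Inf (obj \<eta> ` E) < env \<eta> + \<delta>" using assms by (simp add: env_def)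
  ultimately obtain w where "w \<in> E" "obj \<eta> w < env \<eta> + \<delta>"
    using nonempty cInf_less_iff[of "obj \<eta> ` E"] by auto
  then show ?thesis by (auto simp: near_def)
qed

text \<open>A fixed competitor \<open>w0\<close> bounds \<open>env\<close> on the whole unit ball
  and \<open>g\<close> is bounded below, so near-minimizers have bounded penalty. Beyond distance 1
  the penalty dominates \<open>\<sigma>\<close> times the distance.\<close>

lemma near_bounded:
  obtains M where "M \<ge> 1"
    "\<And>\<eta> w \<delta>. \<eta> \<in> ball \<zeta> 1 \<Longrightarrow> \<delta> \<le> 1 \<Longrightarrow> w \<in> near \<eta> \<delta> \<Longrightarrow> norm (w - \<eta>) \<le> M"
proof -
  obtain w0 where w0: "w0 \<in> E" using nonempty by blast
  define A where "A = g w0 + cost (norm (w0 - \<zeta>) + 1)"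
  have "norm (w - \<eta>) \<le> max 1 ((A + 1 - c) / \<sigma>)"
    if "\<eta> \<in> ball \<zeta> 1" "\<delta> \<le> 1" "w \<in> near \<eta> \<delta>" for \<eta> w \<delta>
  proof (cases "norm (w - \<eta>) \<le> 1")
    case False
    have "norm (w0 - \<eta>) \<le> norm (w0 - \<zeta>) + 1"
      using that(1) norm_triangle_ineq[of "w0 - \<zeta>" "\<zeta> - \<eta>"] by (simp add: dist_norm)
    then have "env \<eta> \<le> A"
      using env_le[OF w0, of \<eta>] cost_mono[of "norm (w0 - \<eta>)" "norm (w0 - \<zeta>) + 1"]
      by (simp add: A_def obj_def)
    then have "cost (norm (w - \<eta>)) \<le> A + 1 - c"
      using that(2,3) lower_bound[of w] by (simp add: near_def obj_def)
    moreover have "norm (w - \<eta>) powr 1 \<le> norm (w - \<eta>) powr p"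
      using False p_ge by (intro powr_mono) auto
    then have "norm (w - \<eta>) \<le> norm (w - \<eta>) powr p" by simp
    ultimately have "norm (w - \<eta>) \<le> (A + 1 - c) / \<sigma>"
      using sigma_pos by (simp add: cost_def field_simps) (smt (verit) mult_left_mono)
    then show ?thesis by simp
  qed simp
  with that[of "max 1 ((A + 1 - c) / \<sigma>)"] show ?thesis by simp
qed

text \<open>Near-minimizers stay at bounded distance, where the penalty has bounded slope. The
  estimate for a single near-minimizer also shows later that it remains one after a small move of
  the centre.\<close>

lemma obj_lipschitz:
  obtains L where "L \<ge> 0"
    "\<And>x y \<delta> w. x \<in> ball \<zeta> 1 \<Longrightarrow> y \<in> ball \<zeta> 1 \<Longrightarrow> \<delta> \<le> 1 \<Longrightarrow> w \<in> near y \<delta> \<Longrightarrow>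
      obj x w \<le> obj y w + L * norm (x - y)"
    "\<And>x y. x \<in> ball \<zeta> 1 \<Longrightarrow> y \<in> ball \<zeta> 1 \<Longrightarrow> env x \<le> env y + L * norm (x - y)"
proof -
  obtain M where M: "M \<ge> 1"
    "\<And>\<eta> w \<delta>. \<eta> \<in> ball \<zeta> 1 \<Longrightarrow> \<delta> \<le> 1 \<Longrightarrow> w \<in> near \<eta> \<delta> \<Longrightarrow> norm (w - \<eta>) \<le> M"
    using near_bounded[of \<zeta>] by metis
  \<comment> \<open>A near-minimizer is within \<open>M\<close> of \<open>y\<close>, and
    \<open>x\<close> and \<open>y\<close> are less than 2 apart.\<close>
  define L where "L = \<sigma> * (p * (M + 2) powr (p - 1))"
  have "L \<ge> 0" using sigma_pos p_ge by (simp add: L_def)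
  have obj: "obj x w \<le> obj y w + L * norm (x - y)"
    if "x \<in> ball \<zeta> 1" "y \<in> ball \<zeta> 1" "\<delta> \<le> 1" "w \<in> near y \<delta>" for x y w \<delta>
  proof -
    have "norm (x - y) < 2"
      using that(1,2) dist_triangle[of x y \<zeta>] by (simp add: dist_norm norm_minus_commute)
    then have "cost (norm (w - y) + norm (x - y)) - cost (norm (w - y)) \<le> L * norm (x - y)"
      unfolding L_def using M(2)[OF that(2-4)] by (intro cost_step) auto
    moreover have "norm (w - x) \<le> norm (w - y) + norm (x - y)"
      using norm_triangle_ineq[of "w - y" "y - x"] by (simp add: norm_minus_commute)
    then have "cost (norm (w - x)) \<le> cost (norm (w - y) + norm (x - y))"
      by (intro cost_mono) auto
    ultimately show ?thesis by (simp add: obj_def)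
  qed
  have "env x \<le> env y + L * norm (x - y)" if "x \<in> ball \<zeta> 1" "y \<in> ball \<zeta> 1" for x y
  proof (rule field_le_epsilon)
    fix e :: real assume "e > 0"
    then obtain w where w: "w \<in> near y (min 1 e)" using near_nonempty[of "min 1 e"] by auto
    then have "obj x w \<le> obj y w + L * norm (x - y)" by (intro obj that) auto
    moreover have "env x \<le> obj x w" using w by (intro env_le) (simp add: near_def)
    ultimately show "env x \<le> env y + L * norm (x - y) + e"
      using near_mono[OF w min.cobounded2] by (simp add: near_def)
  qed
  with obj \<open>L \<ge> 0\<close> that show ?thesis by blast
qed

text \<open>At a point of approximate subdifferentiability the normalized subgradient nearly norms
  \<open>\<eta> - w\<close> for all near-minimizers \<open>w\<close> simultaneously.\<close>

lemma near_minimizers_in_slice: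
  assumes refl: "reflexive_space TYPE('a)" and R: "0 < R" "R \<le> 1" and \<epsilon>: "\<epsilon> > 0"
  shows "\<exists>\<eta>\<in>ball \<zeta> R. \<exists>(x :: 'a \<Rightarrow>\<^sub>L real). \<exists>\<delta>>0. norm x \<le> 1 \<and>
    (\<forall>w\<in>near \<eta> \<delta>. blinfun_apply x (\<eta> - w) \<ge> norm (\<eta> - w) - \<epsilon>)"
proof -
  obtain M where M: "M \<ge> 1"
    "\<And>\<eta> w \<delta>. \<eta> \<in> ball \<zeta> 1 \<Longrightarrow> \<delta> \<le> 1 \<Longrightarrow> w \<in> near \<eta> \<delta> \<Longrightarrow> norm (w - \<eta>) \<le> M"
    using near_bounded[of \<zeta>] by metis
  obtain L where L: "L \<ge> 0"
    "\<And>x y. x \<in> ball \<zeta> 1 \<Longrightarrow> y \<in> ball \<zeta> 1 \<Longrightarrow> env x \<le> env y + L * norm (x - y)"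
    using obj_lipschitz[of \<zeta>] by metis
  \<comment> \<open>Within distance \<open>a\<close> the inequality holds for every functional of
    norm at most 1, as its defect is at most twice the distance.\<close>
  define a where "a = \<epsilon> / 2"
  have a: "a > 0" using \<epsilon> by (simp add: a_def)
  define m where "m = cost a / a"
  have m: "m > 0" using a sigma_pos by (simp add: m_def cost_def)
  \<comment> \<open>The first bound yields \<open>norm x0 \<ge> m - 2 * e \<ge> m / 2\<close>; the
    second absorbs the accumulated error \<open>5 * e * d\<close> into \<open>norm x0 * a\<close>,
    as \<open>d \<le> M\<close>.\<close>
  define e where "e = min (m / 4) (m * \<epsilon> / (20 * M))"
  have e: "e > 0" "e \<le> m / 4" "10 * e * M \<le> m * a"
    using m \<epsilon> M(1) by (auto simp: e_def a_def min_def field_simps)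
  obtain \<tau>0 where \<tau>0: "\<tau>0 > 0" "\<And>d \<tau>. a \<le> d \<Longrightarrow> d \<le> M \<Longrightarrow> 0 < \<tau> \<Longrightarrow> \<tau> < \<tau>0 \<Longrightarrow>
      \<tau> < a \<and> cost (d + \<tau>) + cost (d - \<tau>) - 2 * cost d \<le> e * \<tau>"
    using cost_uniformly_smooth[OF a e(1), of M] by metis
  have "env x - env y \<le> L * norm (x - y)" if "x \<in> ball \<zeta> R" "y \<in> ball \<zeta> R" for x y
    using L(2)[of x y] that R(2) by simp
  then obtain \<eta> and x0 :: "'a \<Rightarrow>\<^sub>L real" and \<tau> where \<eta>: "\<eta> \<in> ball \<zeta> R" and \<tau>: "0 < \<tau>" "\<tau> < \<tau>0"
    and sub: "\<And>k. norm k \<le> \<tau> \<Longrightarrow> env (\<eta> + k) \<ge> env \<eta> + blinfun_apply x0 k - e * \<tau>"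
    using approximate_subgradient[OF refl R(1) L(1) _ e(1) \<tau>0(1), of \<zeta> env] by blast
  have \<eta>1: "\<eta> \<in> ball \<zeta> 1" using \<eta> R(2) by simp
  define \<delta> where "\<delta> = min 1 (e * \<tau>)"
  have "\<delta> > 0" using e(1) \<tau>(1) by (simp add: \<delta>_def)
  \<comment> \<open>\<open>sgn\<close> normalizes and is 0 at 0, so this holds before
    \<open>x0\<close> is known to be nonzero.\<close>
  moreover have "norm (sgn x0) \<le> 1" by (simp add: norm_sgn)
  moreover have "blinfun_apply (sgn x0) (\<eta> - w) \<ge> norm (\<eta> - w) - \<epsilon>" if w: "w \<in> near \<eta> \<delta>" for w
  proof -
    define d where "d = norm (w - \<eta>)"
    have d': "norm (\<eta> - w) = d" by (simp add: d_def norm_minus_commute)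
    have dM: "d \<le> M" unfolding d_def using w by (intro M(2)[OF \<eta>1, of \<delta>]) (auto simp: \<delta>_def)
    \<comment> \<open>\<open>w\<close> competes in \<open>env (\<eta> + k)\<close>. Its own defect
      and that of the subgradient are each at most \<open>e * \<tau>\<close>, hence the factor
      2.\<close>
    have key: "blinfun_apply x0 k \<le> cost (norm (w - (\<eta> + k))) - cost d + 2 * e * \<tau>"
      if k: "norm k \<le> \<tau>" for k
    proof -
      have "env (\<eta> + k) \<le> g w + cost (norm (w - (\<eta> + k)))"
        using env_le[of w "\<eta> + k"] w by (simp add: near_def obj_def)
      moreover have "g w + cost d \<le> env \<eta> + e * \<tau>"
        using near_mono[OF w[unfolded \<delta>_def] min.cobounded2] by (simp add: near_def obj_def d_def)
      ultimately show ?thesis using sub[OF k] by simp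
    qed
    show ?thesis
    proof (cases "d \<le> a")
      case True
      have "\<bar>blinfun_apply (sgn x0) (\<eta> - w)\<bar> \<le> norm (sgn x0) * d"
        using norm_blinfun[of "sgn x0" "\<eta> - w"] d' by simp
      also have "\<dots> \<le> 1 * d" by (intro mult_right_mono) (auto simp: norm_sgn d_def)
      finally show ?thesis using True d' by (simp add: a_def abs_le_iff)
    next
      case False
      then have d: "a \<le> d" "0 < d" using a by auto
      have \<tau>a: "\<tau> < a" and smooth: "cost (d + \<tau>) + cost (d - \<tau>) - 2 * cost d \<le> e * \<tau>"
        using \<tau>0(2)[OF d(1) dM \<tau>] by auto
      define B where "B = cost (d + \<tau>) - cost d + 2 * e * \<tau>"
      have "cost d \<le> cost (d + \<tau>)" using d \<tau> by (intro cost_mono) auto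
      then have B0: "B \<ge> 0" using e(1) \<tau>(1) by (simp add: B_def)
      have B: "blinfun_apply x0 k \<le> B" if k: "norm k \<le> \<tau>" for k
      proof -
        have "norm (w - (\<eta> + k)) \<le> d + \<tau>"
          using norm_triangle_ineq4[of "w - \<eta>" k] k by (simp add: d_def diff_diff_eq)
        then have "cost (norm (w - (\<eta> + k))) \<le> cost (d + \<tau>)" by (intro cost_mono) auto
        with key[OF k] show ?thesis by (simp add: B_def)
      qed
      have "norm x0 \<le> B / \<tau>"
      proof (rule norm_blinfun_bound)
        show "0 \<le> B / \<tau>" using B0 \<tau> by simp
        fix v :: 'a
        show "norm (blinfun_apply x0 v) \<le> B / \<tau> * norm v"
        proof (cases "v = 0")
          case False
          then have nv: "norm v > 0" by simp
          have "\<tau> / norm v * blinfun_apply x0 v \<le> B" "- (\<tau> / norm v * blinfun_apply x0 v) \<le> B"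
            using B[of "(\<tau> / norm v) *\<^sub>R v"] B[of "- ((\<tau> / norm v) *\<^sub>R v)"] nv \<tau>(1)
            by (simp_all add: blinfun.scaleR_right blinfun.minus_right)
          then have "\<tau> / norm v * \<bar>blinfun_apply x0 v\<bar> \<le> B" by (simp add: abs_if)
          then show ?thesis using nv \<tau>(1) by (simp add: field_simps)
        qed simp
      qed
      then have x0_le: "norm x0 * \<tau> \<le> B" using \<tau>(1) by (simp add: field_simps)
      \<comment> \<open>Moving \<open>\<eta>\<close> straight towards \<open>w\<close> lowers the
        distance by exactly \<open>\<tau>\<close>; this test direction gives the lower bound that
        nearly matches \<open>B\<close>.\<close>
      define k where "k = (\<tau> / d) *\<^sub>R (w - \<eta>)"
      have "norm k \<le> \<tau>" using \<tau>(1) d by (simp add: k_def d_def)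
      moreover have "norm (w - (\<eta> + k)) = d - \<tau>"
      proof -
        have "w - (\<eta> + k) = (1 - \<tau> / d) *\<^sub>R (w - \<eta>)" by (simp add: k_def algebra_simps)
        then have "norm (w - (\<eta> + k)) = \<bar>1 - \<tau> / d\<bar> * d" by (simp add: d_def)
        moreover have "\<tau> / d < 1" using \<tau>a d by simp
        ultimately show ?thesis using d by (simp add: field_simps)
      qed
      ultimately have "blinfun_apply x0 k \<le> cost (d - \<tau>) - cost d + 2 * e * \<tau>"
        using key by metis
      moreover have "blinfun_apply x0 k = - (\<tau> / d * blinfun_apply x0 (\<eta> - w))"
        by (simp add: k_def blinfun.scaleR_right blinfun.diff_right algebra_simps)
      ultimately have low: "\<tau> / d * blinfun_apply x0 (\<eta> - w) \<ge> cost d - cost (d - \<tau>) - 2 * e * \<tau>"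
        by simp
      \<comment> \<open>The 5 collects 2 from \<open>low\<close>, 2 from \<open>B\<close>, and 1
        from \<open>smooth\<close>, which compares forward and backward differences of the
        penalty.\<close>
      have "\<tau> / d * blinfun_apply x0 (\<eta> - w) \<ge> norm x0 * \<tau> - 5 * e * \<tau>"
        using low smooth x0_le by (simp add: B_def)
      then have "\<tau> * blinfun_apply x0 (\<eta> - w) \<ge> \<tau> * ((norm x0 - 5 * e) * d)"
        using d by (simp add: field_simps)
      then have main: "blinfun_apply x0 (\<eta> - w) \<ge> (norm x0 - 5 * e) * d"
        using \<tau>(1) by simp
      have "norm x0 \<ge> m / 2"
      proof -
        have "cost (d - \<tau>) \<le> (d - \<tau>) / d * cost d" using \<tau>a \<tau>(1) d by (intro cost_radial) auto
        then have "cost d - cost (d - \<tau>) \<ge> \<tau> / d * cost d" using d by (simp add: field_simps)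
        moreover have "m \<le> cost d / d" using cost_radial[of a d] a d by (simp add: m_def field_simps)
        then have "\<tau> * m \<le> \<tau> * (cost d / d)" using \<tau>(1) by (intro mult_left_mono) auto
        ultimately have "\<tau> / d * blinfun_apply x0 (\<eta> - w) \<ge> \<tau> * m - 2 * e * \<tau>"
          using low by simp
        moreover have "\<bar>blinfun_apply x0 (\<eta> - w)\<bar> \<le> norm x0 * d"
          using norm_blinfun[of x0 "\<eta> - w"] d' by simp
        then have "\<tau> / d * blinfun_apply x0 (\<eta> - w) \<le> \<tau> / d * (norm x0 * d)"
          using \<tau>(1) d by (intro mult_left_mono) auto
        ultimately have "\<tau> * (m - 2 * e) \<le> \<tau> * norm x0" using d by (simp add: algebra_simps)
        then show ?thesis using \<tau>(1) e(2) by simp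
      qed
      then have x0_pos: "norm x0 > 0" using m by linarith
      have "5 * e * d \<le> norm x0 * a"
      proof -
        have "5 * e * d \<le> 5 * e * M" using dM e(1) by simp
        also have "\<dots> \<le> m / 2 * a" using e(3) by simp
        also have "\<dots> \<le> norm x0 * a" using \<open>norm x0 \<ge> m / 2\<close> a by (intro mult_right_mono) auto
        finally show ?thesis .
      qed
      with main have "blinfun_apply x0 (\<eta> - w) \<ge> norm x0 * (d - a)" by (simp add: algebra_simps)
      moreover have "blinfun_apply (sgn x0) (\<eta> - w) = blinfun_apply x0 (\<eta> - w) / norm x0"
        by (simp add: sgn_div_norm blinfun.scaleR_left divide_inverse mult.commute)
      ultimately have "blinfun_apply (sgn x0) (\<eta> - w) \<ge> d - a"
        using x0_pos by (simp only: pos_le_divide_eq mult.commute)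
      then show ?thesis using d' a by (simp add: a_def)
    qed
  qed
  ultimately show ?thesis using \<eta> by blast
qed

end

section \<open>Weak convergence and the Kadec property\<close>

lemma limitin_weak_topology:
  fixes y :: "'i \<Rightarrow> 'a::real_normed_vector"
  assumes "\<And>\<phi> :: 'a \<Rightarrow>\<^sub>L real. ((\<lambda>i. blinfun_apply \<phi> (y i)) \<longlongrightarrow> blinfun_apply \<phi> l) U"
  shows "limitin weak_topology y l U"
proof -
  have "generate_topology_on {blinfun_apply \<phi> -` V | (\<phi> :: 'a \<Rightarrow>\<^sub>L real) V. open V} T \<Longrightarrow>
      l \<in> T \<longrightarrow> eventually (\<lambda>i. y i \<in> T) U" for T
  proof (induction rule: generate_topology_on.induct)
    case (Int a b)
    then show ?case by (auto intro: eventually_conj)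
  next
    case (UN K)
    show ?case
    proof
      assume "l \<in> \<Union> K"
      then obtain k where k: "k \<in> K" "l \<in> k" by blast
      then have "eventually (\<lambda>i. y i \<in> k) U" using UN by blast
      then show "eventually (\<lambda>i. y i \<in> \<Union> K) U" by (rule eventually_mono) (use k in blast)
    qed
  next
    case (Basis T)
    then obtain \<phi> :: "'a \<Rightarrow>\<^sub>L real" and V where "T = blinfun_apply \<phi> -` V" "open V" by blast
    then show ?case using assms[of \<phi>] by (auto simp: tendsto_def)
  qed simp
  moreover have "l \<in> topspace (weak_topology :: 'a topology)"
    unfolding weak_topology_def topology_generated_by_topspace
    by (rule UnionI[of UNIV]) (auto intro!: exI[of _ 0] exI[of _ UNIV])
  ultimately show ?thesis
    by (auto simp: limitin_def weak_topology_def openin_topology_generated_by_iff)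
qed

text \<open>The Kadec property concerns the unit sphere, so the vectors are normalized, the
  topologies compared there, and the result rescaled by the convergent norms. A zero limit has no
  normalization but follows from the norms alone.\<close>

lemma kadec_convergence:
  fixes y :: "'i \<Rightarrow> 'a::real_normed_vector"
  assumes kadec: "kadec_norm TYPE('a)"
    and weak: "\<And>\<phi> :: 'a \<Rightarrow>\<^sub>L real. ((\<lambda>i. blinfun_apply \<phi> (y i)) \<longlongrightarrow> blinfun_apply \<phi> l) U"
    and norms: "((\<lambda>i. norm (y i)) \<longlongrightarrow> norm l) U"
  shows "(y \<longlongrightarrow> l) U"
proof (cases "l = 0")
  case True
  then show ?thesis using norms by (simp add: tendsto_norm_zero_iff)
next
  case False
  then have l: "norm l > 0" by simp
  define u where "u = (\<lambda>i. (1 / norm (y i)) *\<^sub>R y i)"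
  have inv: "((\<lambda>i. 1 / norm (y i)) \<longlongrightarrow> 1 / norm l) U"
    using norms l by (intro tendsto_divide tendsto_const) auto
  have "((\<lambda>i. blinfun_apply \<phi> (u i)) \<longlongrightarrow> blinfun_apply \<phi> ((1 / norm l) *\<^sub>R l)) U" for \<phi> :: "'a \<Rightarrow>\<^sub>L real"
    using tendsto_mult[OF inv weak[of \<phi>]] by (simp add: u_def blinfun.scaleR_right)
  then have "limitin weak_topology u ((1 / norm l) *\<^sub>R l) U"
    by (rule limitin_weak_topology)
  \<comment> \<open>Membership in the sphere holds only eventually, since the normalization of a
    zero vector is zero.\<close>
  moreover have pos: "eventually (\<lambda>i. norm (y i) > 0) U"
    using norms l by (rule order_tendstoD)
  then have "eventually (\<lambda>i. u i \<in> sphere 0 1) U"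
    by (rule eventually_mono) (simp add: u_def)
  moreover have "(1 / norm l) *\<^sub>R l \<in> sphere 0 1" using l by simp
  ultimately have "limitin (subtopology weak_topology (sphere 0 1)) u ((1 / norm l) *\<^sub>R l) U"
    by (simp add: limitin_subtopology)
  then have "limitin (top_of_set (sphere 0 1)) u ((1 / norm l) *\<^sub>R l) U"
    using kadec by (simp add: kadec_norm_def)
  then have "(u \<longlongrightarrow> (1 / norm l) *\<^sub>R l) U" by (simp add: limitin_subtopology)
  then have "((\<lambda>i. norm (y i) *\<^sub>R u i) \<longlongrightarrow> norm l *\<^sub>R (1 / norm l) *\<^sub>R l) U"
    by (rule tendsto_scaleR[OF norms])
  then have "((\<lambda>i. norm (y i) *\<^sub>R u i) \<longlongrightarrow> l) U" using l by simp
  then show ?thesis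
    by (rule Lim_transform_eventually) (use pos in \<open>auto elim: eventually_mono simp: u_def\<close>)
qed

section \<open>Attainment on a dense set of centres\<close>

context power_inf_convolution
begin

text \<open>Lower semicontinuity is assumed along filters because the limits are taken along an
  ultrafilter; it is applied only once the minimizing sequence is known to converge in norm.\<close>

lemma attained_densely:
  assumes refl: "reflexive_space TYPE('a)" and kadec: "kadec_norm TYPE('a)"
    and lsc: "\<And>U z v l. U \<noteq> bot \<Longrightarrow> (\<And>k::nat. z k \<in> E) \<Longrightarrow> (z \<longlongrightarrow> v) U \<Longrightarrow>
      ((\<lambda>k. g (z k)) \<longlongrightarrow> l) U \<Longrightarrow> v \<in> E \<and> g v \<le> l"
    and R: "R > 0"
  shows "\<exists>\<eta>\<in>ball \<zeta> R. \<exists>v\<in>E. \<forall>w\<in>E. obj \<eta> v \<le> obj \<eta> w"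
proof -
  define slice where "slice n \<eta> \<delta> x \<longleftrightarrow> (\<forall>w\<in>near \<eta> \<delta>.
      blinfun_apply x (\<eta> - w) \<ge> norm (\<eta> - w) - 1 / real (Suc n))"
    for n \<eta> \<delta> and x :: "'a \<Rightarrow>\<^sub>L real"
  \<comment> \<open>A common \<open>x\<close> and \<open>\<delta>\<close> on a whole ball make
    openness immediate; density then rests on the stability of slices under small moves of the
    centre.\<close>
  define G where "G n = {\<eta>. \<exists>r>0. \<exists>x. \<exists>\<delta>>0. norm x \<le> 1 \<and> (\<forall>\<eta>'\<in>ball \<eta> r. slice n \<eta>' \<delta> x)}" for n
  have "open (G n)" for n
    unfolding open_contains_ball
  proof
    fix \<eta> assume "\<eta> \<in> G n"
    then obtain r x \<delta> where *: "r > 0" "\<delta> > 0" "norm x \<le> 1" "\<forall>\<eta>'\<in>ball \<eta> r. slice n \<eta>' \<delta> x"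
      unfolding G_def by blast
    have "\<eta>1 \<in> G n" if "\<eta>1 \<in> ball \<eta> r" for \<eta>1
    proof -
      have "\<forall>\<eta>'\<in>ball \<eta>1 (r - dist \<eta> \<eta>1). slice n \<eta>' \<delta> x"
      proof
        fix \<eta>' assume "\<eta>' \<in> ball \<eta>1 (r - dist \<eta> \<eta>1)"
        then have "\<eta>' \<in> ball \<eta> r" using dist_triangle[of \<eta> \<eta>' \<eta>1] by simp
        then show "slice n \<eta>' \<delta> x" using *(4) by blast
      qed
      moreover have "r - dist \<eta> \<eta>1 > 0" using that by simp
      ultimately show ?thesis using *(2,3) unfolding G_def by blast
    qed
    then show "\<exists>e>0. ball \<eta> e \<subseteq> G n" using *(1) by blast
  qed
  have "closure (G n) = UNIV" for n
  proof -
    have "\<exists>\<eta>\<in>G n. dist \<eta> a < e" if e: "e > 0" for a e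
    proof -
      define \<epsilon> where "\<epsilon> = 1 / (2 * real (Suc n))"
      have \<epsilon>: "\<epsilon> > 0" by (simp add: \<epsilon>_def)
      obtain \<eta> and x :: "'a \<Rightarrow>\<^sub>L real" and \<delta> where \<eta>: "\<eta> \<in> ball a (min e 1)" and \<delta>: "\<delta> > 0" "norm x \<le> 1"
        and sl: "\<And>w. w \<in> near \<eta> \<delta> \<Longrightarrow> blinfun_apply x (\<eta> - w) \<ge> norm (\<eta> - w) - \<epsilon>"
        using near_minimizers_in_slice[OF refl _ _ \<epsilon>, of "min e 1" a] e by auto
      obtain L where L: "L \<ge> 0"
        "\<And>x y \<delta> w. x \<in> ball \<eta> 1 \<Longrightarrow> y \<in> ball \<eta> 1 \<Longrightarrow> \<delta> \<le> 1 \<Longrightarrow> w \<in> near y \<delta> \<Longrightarrow>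
          obj x w \<le> obj y w + L * norm (x - y)"
        "\<And>x y. x \<in> ball \<eta> 1 \<Longrightarrow> y \<in> ball \<eta> 1 \<Longrightarrow> env x \<le> env y + L * norm (x - y)"
        using obj_lipschitz[of \<eta>] by metis
      \<comment> \<open>Half of \<open>\<delta>\<close> is left for the changes of
        \<open>obj\<close> and \<open>env\<close>, each at most \<open>L * r\<close>. Likewise
        \<open>\<epsilon>\<close> is half the slice tolerance; the rest covers the changes of norm
        and functional, each at most \<open>r \<le> \<epsilon> / 2\<close>.\<close>
      define \<delta>' where "\<delta>' = min 1 (\<delta> / 2)"
      define r where "r = Min {1, \<epsilon> / 2, \<delta> / (4 * (L + 1))}"
      have r: "r > 0" "r \<le> 1" "r \<le> \<epsilon> / 2" "r \<le> \<delta> / (4 * (L + 1))"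
      proof -
        have "\<delta> / (4 * (L + 1)) > 0" using \<delta>(1) L(1) by simp
        then show "r > 0" using \<epsilon> by (simp add: r_def)
        show "r \<le> 1" "r \<le> \<epsilon> / 2" "r \<le> \<delta> / (4 * (L + 1))"
          unfolding r_def by (rule Min_le; simp)+
      qed
      have "4 * (L + 1) * r \<le> \<delta>" using r(4) L(1) by (simp add: field_simps)
      then have Lr: "2 * (L * r) \<le> \<delta> / 2" using r(1) by (simp add: algebra_simps)
      have "slice n \<eta>' \<delta>' x" if \<eta>': "\<eta>' \<in> ball \<eta> r" for \<eta>'
        unfolding slice_def
      proof
        fix w assume w: "w \<in> near \<eta>' \<delta>'"
        have in1: "\<eta> \<in> ball \<eta> 1" "\<eta>' \<in> ball \<eta> 1" using \<eta>' r(2) by auto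
        have nn: "norm (\<eta> - \<eta>') < r" using \<eta>' by (simp add: dist_norm)
        then have Ln: "L * norm (\<eta> - \<eta>') \<le> L * r" using L(1) by (intro mult_left_mono) auto
        have "obj \<eta> w \<le> obj \<eta>' w + L * norm (\<eta> - \<eta>')"
          using w by (intro L(2)[OF in1, of \<delta>']) (auto simp: \<delta>'_def)
        moreover have "env \<eta>' \<le> env \<eta> + L * norm (\<eta> - \<eta>')"
          using L(3)[OF in1(2,1)] by (simp add: norm_minus_commute)
        ultimately have "w \<in> near \<eta> \<delta>"
          using near_mono[OF w[unfolded \<delta>'_def] min.cobounded2] Ln Lr by (simp add: near_def)
        then have 1: "blinfun_apply x (\<eta> - w) \<ge> norm (\<eta> - w) - \<epsilon>" by (rule sl)
        have "\<bar>blinfun_apply x (\<eta> - \<eta>')\<bar> \<le> norm x * norm (\<eta> - \<eta>')"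
          using norm_blinfun[of x "\<eta> - \<eta>'"] by simp
        also have "\<dots> \<le> 1 * norm (\<eta> - \<eta>')" using \<delta>(2) by (intro mult_right_mono) auto
        finally have 2: "\<bar>blinfun_apply x (\<eta> - \<eta>')\<bar> \<le> norm (\<eta> - \<eta>')" by simp
        have 3: "blinfun_apply x (\<eta>' - w) = blinfun_apply x (\<eta> - w) - blinfun_apply x (\<eta> - \<eta>')"
          by (simp add: blinfun.diff_right)
        have 4: "norm (\<eta>' - w) \<le> norm (\<eta> - w) + norm (\<eta> - \<eta>')"
          using norm_triangle_ineq4[of "\<eta> - w" "\<eta> - \<eta>'"] by simp
        have "1 / real (Suc n) = 2 * \<epsilon>" by (simp add: \<epsilon>_def field_simps)
        with 1 2 3 4 nn r(3) show "blinfun_apply x (\<eta>' - w) \<ge> norm (\<eta>' - w) - 1 / real (Suc n)"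
          by linarith
      qed
      moreover have "\<delta>' > 0" using \<delta>(1) by (simp add: \<delta>'_def)
      ultimately have "\<eta> \<in> G n" using r(1) \<delta>(2) unfolding G_def by blast
      then show ?thesis using \<eta> by (auto simp: dist_commute)
    qed
    then show ?thesis by (auto simp: closure_approachable)
  qed
  have "closure (\<Inter> (range G)) = UNIV"
  proof -
    have "euclidean closure_of \<Inter> (range G) = topspace (euclidean :: 'a topology)"
      by (rule Baire_category)
        (use \<open>\<And>n. open (G n)\<close> \<open>\<And>n. closure (G n) = UNIV\<close> in
          \<open>auto simp: completely_metrizable_space_euclidean\<close>)
    then show ?thesis by simp
  qed
  then obtain \<eta> where \<eta>: "\<eta> \<in> \<Inter> (range G)" "dist \<eta> \<zeta> < R"
    using R closure_approachable[of \<zeta> "\<Inter> (range G)"] by blast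
  have "\<exists>w. w \<in> near \<eta> (1 / real (Suc k))" for k by (rule near_nonempty) simp
  then have "\<exists>z. \<forall>k. z k \<in> near \<eta> (1 / real (Suc k))" by (intro choice allI)
  then obtain z where z: "\<And>k. z k \<in> near \<eta> (1 / real (Suc k))" by blast
  then have zE: "z k \<in> E" for k by (auto simp: near_def)
  obtain M where M: "\<And>\<eta>' w \<delta>. \<eta>' \<in> ball \<eta> 1 \<Longrightarrow> \<delta> \<le> 1 \<Longrightarrow> w \<in> near \<eta>' \<delta> \<Longrightarrow> norm (w - \<eta>') \<le> M"
    using near_bounded[of \<eta>] by metis
  have bnd: "norm (z k - \<eta>) \<le> M" for k
    by (rule M[OF _ _ z]) auto
  \<comment> \<open>Along one ultrafilter the weak limit and the limit of the norms both exist; it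
    remains to exclude that the norms have the larger limit.\<close>
  obtain U :: "nat filter" where U: "U \<noteq> bot" "U \<le> sequentially"
      "\<And>P. eventually P U \<or> eventually (\<lambda>x. \<not> P x) U"
    using ultrafilter_exists[of sequentially] by auto
  obtain q where q: "\<And>\<phi> :: 'a \<Rightarrow>\<^sub>L real. ((\<lambda>k. blinfun_apply \<phi> (z k - \<eta>)) \<longlongrightarrow> blinfun_apply \<phi> q) U"
    by (rule reflexive_weak_ultralimit[where z = "\<lambda>k. z k - \<eta>", OF refl U(1,3) bnd]) (rule that)
  obtain d where d: "((\<lambda>k. norm (z k - \<eta>)) \<longlongrightarrow> d) U"
    using ultrafilter_convergent[OF U(1,3), of "\<lambda>k. norm (z k - \<eta>)" M] bnd by auto
  have "norm q \<le> d"
  proof -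
    obtain \<phi> :: "'a \<Rightarrow>\<^sub>L real" where \<phi>: "norm \<phi> \<le> 1" "blinfun_apply \<phi> q = norm q"
      by (rule norming_functional)
    have "blinfun_apply \<phi> v \<le> norm v" for v
      using norm_blinfun[of \<phi> v] mult_right_mono[OF \<phi>(1), of "norm v"] by (simp add: abs_le_iff)
    then have "blinfun_apply \<phi> q \<le> d"
      by (intro tendsto_le[OF U(1) d q[of \<phi>]]) simp
    with \<phi>(2) show ?thesis by simp
  qed
  \<comment> \<open>One functional of norm at most 1 nearly norms all late
    \<open>\<eta> - z k\<close> and passes to the weak limit, so at most the slice tolerance is
    lost.\<close>
  moreover have "d \<le> norm q + 1 / real (Suc n)" for n
  proof -
    obtain r x \<delta> where *: "r > 0" "\<delta> > 0" "norm x \<le> 1" "\<forall>\<eta>'\<in>ball \<eta> r. slice n \<eta>' \<delta> x"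
      using \<eta>(1) unfolding G_def by blast
    have "eventually (\<lambda>k. 1 / real (Suc k) < \<delta>) sequentially"
      using order_tendstoD(2)[OF LIMSEQ_inverse_real_of_nat *(2)] by (simp add: inverse_eq_divide)
    then have "eventually (\<lambda>k. 1 / real (Suc k) < \<delta>) U" using U(2) by (rule filter_leD[rotated])
    then have "eventually (\<lambda>k. norm (z k - \<eta>) \<le> 1 / real (Suc n) - blinfun_apply x (z k - \<eta>)) U"
    proof (rule eventually_mono)
      fix k assume "1 / real (Suc k) < \<delta>"
      then have "z k \<in> near \<eta> \<delta>" using z[of k] by (auto simp: near_def)
      then have "blinfun_apply x (\<eta> - z k) \<ge> norm (\<eta> - z k) - 1 / real (Suc n)"
        using *(1,4) unfolding slice_def by auto
      then show "norm (z k - \<eta>) \<le> 1 / real (Suc n) - blinfun_apply x (z k - \<eta>)"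
        by (simp add: norm_minus_commute blinfun.diff_right)
    qed
    then have "d \<le> 1 / real (Suc n) - blinfun_apply x q"
      by (rule tendsto_le[OF U(1) tendsto_diff[OF tendsto_const q] d])
    moreover have "\<bar>blinfun_apply x q\<bar> \<le> norm q"
      using norm_blinfun[of x q] mult_right_mono[OF *(3), of "norm q"] by simp
    ultimately show ?thesis by linarith
  qed
  then have "d \<le> norm q"
    using LIMSEQ_le_const[of "\<lambda>n. norm q + 1 / real (Suc n)" "norm q + 0" d]
      tendsto_add[OF tendsto_const LIMSEQ_inverse_real_of_nat, of "norm q"]
    by (simp add: inverse_eq_divide)
  ultimately have nq: "norm q = d" by simp
  have "((\<lambda>k. z k - \<eta>) \<longlongrightarrow> q) U"
    by (rule kadec_convergence[OF kadec q]) (simp add: nq d)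
  from tendsto_add[OF this tendsto_const[of \<eta>]] have zlim: "(z \<longlongrightarrow> \<eta> + q) U"
    by (simp add: add.commute)
  have "((\<lambda>k. env \<eta> + 1 / real (Suc k)) \<longlongrightarrow> env \<eta> + 0) U"
    using LIMSEQ_inverse_real_of_nat U(2)
    by (intro tendsto_add tendsto_const) (auto simp: inverse_eq_divide intro: tendsto_mono)
  then have upper: "((\<lambda>k. env \<eta> + 1 / real (Suc k)) \<longlongrightarrow> env \<eta>) U" by simp
  have "((\<lambda>k. obj \<eta> (z k)) \<longlongrightarrow> env \<eta>) U"
  proof (rule tendsto_sandwich[OF _ _ tendsto_const upper])
    show "eventually (\<lambda>k. env \<eta> \<le> obj \<eta> (z k)) U"
      using env_le[OF zE] by (intro always_eventually allI)
    show "eventually (\<lambda>k. obj \<eta> (z k) \<le> env \<eta> + 1 / real (Suc k)) U"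
      using z by (intro always_eventually allI) (auto simp: near_def)
  qed
  moreover have "((\<lambda>k. cost (norm (z k - \<eta>))) \<longlongrightarrow> cost d) U"
    by (rule cost_tendsto[OF d]) simp
  ultimately have "((\<lambda>k. obj \<eta> (z k) - cost (norm (z k - \<eta>))) \<longlongrightarrow> env \<eta> - cost d) U"
    by (rule tendsto_diff)
  then have "((\<lambda>k. g (z k)) \<longlongrightarrow> env \<eta> - cost d) U" by (simp add: obj_def)
  then have "\<eta> + q \<in> E" "g (\<eta> + q) \<le> env \<eta> - cost d"
    using lsc[OF U(1) zE zlim] by auto
  then have "obj \<eta> (\<eta> + q) \<le> obj \<eta> w" if "w \<in> E" for w
    using env_le[OF that, of \<eta>] nq by (simp add: obj_def)
  moreover have "\<eta> \<in> ball \<zeta> R" using \<eta>(2) by (simp add: dist_commute)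
  ultimately show ?thesis using \<open>\<eta> + q \<in> E\<close> by blast
qed

end

section \<open>The variational principle\<close>

text \<open>Comparing the minimizer with \<open>u\<close> controls \<open>norm (v - \<eta>)\<close>
  through the penalty, and minimality for the centre \<open>\<eta>\<close> is the last conclusion
  rearranged.\<close>

theorem kadec_variational_principle:
  fixes f :: "'a::banach \<Rightarrow> ereal"
  assumes refl: "reflexive_space TYPE('a)" and kadec: "kadec_norm TYPE('a)"
    and bounded_below: "\<And>x. ereal c \<le> f x" and lsc: "lower_semicontinuous f"
    and pos: "\<rho> > 0" "\<sigma> > 0" and p: "p \<ge> 1"
    and fu: "f u < (INF x. f x) + ereal (\<sigma> * \<rho> powr p)"
  obtains v \<eta> where "norm (v - u) < \<rho>" "norm (\<eta> - u) \<le> \<rho>"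
    "f v < (INF x. f x) + ereal (\<sigma> * \<rho> powr p)"
    "\<And>w. f w \<ge> f v + ereal (\<sigma> * (norm (v - \<eta>) powr p - norm (w - \<eta>) powr p))"
proof -
  define E where "E = {x. f x \<noteq> \<infinity>}"
  define g where "g x = real_of_ereal (f x)" for x
  have fg: "f x = ereal (g x)" if "x \<in> E" for x
    using that bounded_below[of x] by (cases "f x") (auto simp: E_def g_def)
  have "f u < \<infinity>" using fu by auto
  then have uE: "u \<in> E" by (auto simp: E_def)
  have "ereal c \<le> (INF x. f x)" using bounded_below by (rule INF_greatest)
  moreover have "(INF x. f x) \<le> ereal (g u)" using INF_lower[of u UNIV f] fg[OF uE] by simp
  ultimately obtain m where m: "(INF x. f x) = ereal m"
    by (cases "INF x. f x") auto
  have gm: "m \<le> g x" if "x \<in> E" for x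
    using INF_lower[of x UNIV f] fg[OF that] m by simp
  interpret power_inf_convolution E g c \<sigma> p
  proof
    show "E \<noteq> {}" using uE by blast
    show "c \<le> g x" if "x \<in> E" for x using bounded_below[of x] fg[OF that] by simp
  qed (use pos p in auto)
  have lsc_E: "v \<in> E \<and> g v \<le> l"
    if U: "U \<noteq> bot" and z: "\<And>k::nat. z k \<in> E" "(z \<longlongrightarrow> v) U" "((\<lambda>k. g (z k)) \<longlongrightarrow> l) U"
    for U z v l
  proof -
    have "f v \<le> ereal l"
    proof (rule ccontr)
      assume "\<not> ?thesis"
      then have "ereal l < f v" by simp
      then obtain y where y: "ereal l < y" "y < f v" using dense by blast
      have "eventually (\<lambda>x. y < f x) (at v)"
        using lsc y(2) unfolding lower_semicontinuous_def le_Liminf_iff by blast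
      \<comment> \<open>The lower limit ignores \<open>v\<close> itself, which some
        \<open>z k\<close> may equal; \<open>y < f v\<close> fills this gap.\<close>
      then have "eventually (\<lambda>x. y < f x) (nhds v)"
        using y(2) by (auto simp: eventually_at_filter elim: eventually_mono)
      then have "eventually (\<lambda>k. y < f (z k)) U"
        using z(2) by (rule eventually_compose_filterlim)
      moreover have "((\<lambda>k. ereal (g (z k))) \<longlongrightarrow> ereal l) U" using z(3) by simp
      then have "eventually (\<lambda>k. ereal (g (z k)) < y) U" using y(1) by (rule order_tendstoD(2))
      ultimately have "eventually (\<lambda>k. False) U"
        by eventually_elim (use fg[OF z(1)] in auto)
      then show False using U by simp
    qed
    moreover from this have "v \<in> E" by (auto simp: E_def)
    ultimately show ?thesis using fg by auto
  qed
  \<comment> \<open>The strict slack in the bound on \<open>f u\<close>. One half pays for the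
    penalty at \<open>u\<close>, the other for shrinking the radius from \<open>\<rho>\<close> to
    \<open>\<rho> - R\<close>.\<close>
  define s0 where "s0 = m + cost \<rho> - g u"
  have s0: "s0 > 0" using fu m fg[OF uE] by (simp add: s0_def cost_def)
  \<comment> \<open>Absolute values supply the nonnegativity for all \<open>R\<close> that
    \<open>cost_tendsto\<close> asks for; they disappear for the small positive \<open>R\<close>
    selected.\<close>
  have "((\<lambda>R. cost \<bar>R\<bar>) \<longlongrightarrow> cost \<bar>0\<bar>) (at_right 0)"
    by (rule cost_tendsto) (auto intro!: tendsto_eq_intros)
  moreover have "cost \<bar>0\<bar> < s0 / 2" using s0 by (simp add: cost_def)
  ultimately have 1: "eventually (\<lambda>R. cost \<bar>R\<bar> < s0 / 2) (at_right 0)"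
    by (rule order_tendstoD)
  have "((\<lambda>R. cost \<bar>\<rho> - R\<bar>) \<longlongrightarrow> cost \<bar>\<rho> - 0\<bar>) (at_right 0)"
    by (rule cost_tendsto) (auto intro!: tendsto_eq_intros)
  moreover have "cost \<rho> - s0 / 2 < cost \<bar>\<rho> - 0\<bar>" using s0 pos(1) by simp
  ultimately have 2: "eventually (\<lambda>R. cost \<rho> - s0 / 2 < cost \<bar>\<rho> - R\<bar>) (at_right 0)"
    by (rule order_tendstoD)
  have "eventually (\<lambda>R. 0 < R \<and> R < \<rho>) (at_right 0)"
    using eventually_at_right_real[OF pos(1)] by simp
  with 1 2 have "eventually (\<lambda>R. 0 < R \<and> R < \<rho> \<and> cost R < s0 / 2 \<and> cost \<rho> - s0 / 2 < cost (\<rho> - R)) (at_right 0)"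
    by eventually_elim simp
  then obtain R where R: "0 < R" "R < \<rho>" "cost R < s0 / 2" "cost \<rho> - s0 / 2 < cost (\<rho> - R)"
    using eventually_happens'[OF trivial_limit_at_right_real] by blast
  have "\<exists>\<eta>\<in>ball u R. \<exists>v\<in>E. \<forall>w\<in>E. obj \<eta> v \<le> obj \<eta> w"
    by (rule attained_densely[OF refl kadec _ R(1)]) (rule lsc_E)
  then obtain \<eta> v where \<eta>: "\<eta> \<in> ball u R" and v: "v \<in> E" "\<And>w. w \<in> E \<Longrightarrow> obj \<eta> v \<le> obj \<eta> w"
    by blast
  have \<eta>': "norm (u - \<eta>) < R" using \<eta> by (simp add: dist_norm)
  then have "cost (norm (u - \<eta>)) \<le> cost R" by (intro cost_mono) auto
  then have le: "g v + cost (norm (v - \<eta>)) \<le> g u + cost R"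
    using v(2)[OF uE] by (simp add: obj_def)
  have "cost (norm (v - \<eta>)) < cost (\<rho> - R)"
    using le gm[OF v(1)] R(3,4) unfolding s0_def by argo
  then have "norm (v - \<eta>) < \<rho> - R"
    using cost_mono[of "\<rho> - R" "norm (v - \<eta>)"] R(2) by force
  show ?thesis
  proof
    show "norm (v - u) < \<rho>"
      using norm_triangle_ineq4[of "v - \<eta>" "u - \<eta>"] \<open>norm (v - \<eta>) < \<rho> - R\<close> \<eta>' by simp
    show "norm (\<eta> - u) \<le> \<rho>" using \<eta>' R(2) by (simp add: norm_minus_commute)
    have "g v < m + cost \<rho>"
      using le cost_nonneg[of "norm (v - \<eta>)"] R(3) s0 by (simp add: s0_def)
    then show "f v < (INF x. f x) + ereal (\<sigma> * \<rho> powr p)"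
      using fg[OF v(1)] m by (simp add: cost_def)
    fix w
    show "f w \<ge> f v + ereal (\<sigma> * (norm (v - \<eta>) powr p - norm (w - \<eta>) powr p))"
    proof (cases "w \<in> E")
      case True
      then show ?thesis
        using v(2)[OF True] fg[OF True] fg[OF v(1)] by (simp add: obj_def cost_def algebra_simps)
    qed (simp add: E_def)
  qed
qed

section \<open>Application to symmetrization\<close>

context symmetrization_framework
begin

lemma pol_closed: "x \<in> S \<Longrightarrow> H \<in> topspace \<H> \<Longrightarrow> pol x H \<in> S"
  using continuous_map_image_subset_topspace[OF pol_continuous] by force

lemma iter_pol_induct:
  assumes "x \<in> S" "set Hs \<subseteq> topspace \<H>" "P x"
    and "\<And>y H. y \<in> S \<Longrightarrow> H \<in> topspace \<H> \<Longrightarrow> P y \<Longrightarrow> P (pol y H)"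
  shows "iter_pol pol x Hs \<in> S \<and> P (iter_pol pol x Hs)"
  using assms(1-3) by (induction Hs arbitrary: x) (auto intro: assms(4) pol_closed)

lemma iter_pol_nonexpansive:
  assumes "x \<in> S" "y \<in> S" "set Hs \<subseteq> topspace \<H>"
  shows "norm (\<iota> (iter_pol pol x Hs) - \<iota> (iter_pol pol y Hs)) \<le> norm (\<iota> x - \<iota> y)"
  using assms
proof (induction Hs arbitrary: x y)
  case (Cons H Hs)
  then have "norm (\<iota> (iter_pol pol (pol x H) Hs) - \<iota> (iter_pol pol (pol y H) Hs))
      \<le> norm (\<iota> (pol x H) - \<iota> (pol y H))"
    by (intro Cons.IH) (auto intro: pol_closed)
  also have "\<dots> \<le> norm (\<iota> x - \<iota> y)" using Cons.prems by (intro pol_nonexpansive) auto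
  finally show ?case by simp
qed simp

text \<open>One sequence of polarizers serves both points, so nonexpansiveness of the iterates
  survives in the limit.\<close>

lemma star_nonexpansive:
  assumes "x \<in> S" "y \<in> S"
  shows "norm (\<iota> (star x) - \<iota> (star y)) \<le> norm (\<iota> x - \<iota> y)"
proof -
  obtain Hseq where H: "\<And>m. Hseq m \<in> topspace \<H>"
    "\<And>u. u \<in> S \<Longrightarrow> (\<lambda>m. \<iota> (iter_pol pol u (map Hseq [0..<m]))) \<longlonglongrightarrow> \<iota> (star u)"
    using iter_converges by blast
  show ?thesis
    by (rule LIMSEQ_le_const2[OF tendsto_norm[OF tendsto_diff[OF H(2) H(2)]]])
      (use assms H(1) in \<open>auto intro!: exI[of _ 0] iter_pol_nonexpansive\<close>)
qed

end

theorem theorem2p5: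
  fixes \<iota> :: "'x::banach \<Rightarrow> 'v::banach"
    and \<kappa> :: "'v \<Rightarrow> 'w::banach"
    and S :: "'x set"
    and \<H> :: "'h topology"
    and pol :: "'x \<Rightarrow> 'h \<Rightarrow> 'x"
    and star \<Theta> :: "'x \<Rightarrow> 'x"
    and K C\<^sub>\<Theta> \<rho> \<sigma> p :: real
    and T :: "real \<Rightarrow> 'x \<Rightarrow> 'x"
    and f :: "'x \<Rightarrow> ereal"
    and u :: 'x
  assumes framework: "symmetrization_framework \<iota> \<kappa> K S \<H> pol star \<Theta> C\<^sub>\<Theta>"
    and T_maps: "\<And>r. r > 0 \<Longrightarrow> T r ` S \<subseteq> S"
    and T_continuous: "\<And>r. r > 0 \<Longrightarrow> continuous_on S (T r)"
    and T_iterated: "\<And>r x. r > 0 \<Longrightarrow> x \<in> S \<Longrightarrow>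
           \<exists>Hs. set Hs \<subseteq> topspace \<H> \<and> T r x = iter_pol pol x Hs"
    and T_approx: "\<And>r x. r > 0 \<Longrightarrow> x \<in> S \<Longrightarrow> norm (\<iota> (T r x) - \<iota> (star x)) < r"
    and reflexive: "reflexive_space TYPE('x)"
    and kadec: "kadec_norm TYPE('x)"
    and f_not_minus_infty: "\<And>x. f x \<noteq> -\<infinity>"
    and f_proper: "\<exists>x. f x \<noteq> \<infinity>"
    and f_bounded_below: "\<exists>c::real. \<forall>x. ereal c \<le> f x"
    and f_lsc: "lower_semicontinuous f"
    and f_pol: "\<And>x H. x \<in> S \<Longrightarrow> H \<in> topspace \<H> \<Longrightarrow> f (pol x H) \<le> f x"
    and u: "u \<in> S"
    and rho: "\<rho> > 0" and sigma: "\<sigma> > 0" and p: "p \<ge> 1"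
    and f_u: "f u < (INF x. f x) + ereal (\<sigma> * \<rho> powr p)"
  shows "\<exists>v \<eta>.
      norm (\<iota> v - \<iota> (star (\<Theta> v))) < (K * (C\<^sub>\<Theta> + 1) + 1) * \<rho> \<and>
      norm (v - u) < \<rho> + norm (T \<rho> u - u) \<and>
      norm (\<eta> - u) \<le> \<rho> + norm (T \<rho> u - u) \<and>
      f v < (INF x. f x) + ereal (\<sigma> * \<rho> powr p) \<and>
      (\<forall>w. f w \<ge> f v + ereal (\<sigma> * (norm (v - \<eta>) powr p - norm (w - \<eta>) powr p)))"
proof -
  interpret symmetrization_framework \<iota> \<kappa> K S \<H> pol star \<Theta> C\<^sub>\<Theta> by (fact framework)
  \<comment> \<open>The variational principle is applied at \<open>u'\<close>; returning to
    \<open>u\<close> costs the term \<open>norm (T \<rho> u - u)\<close> in (b) and (c). The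
    identity \<open>star u' = star u\<close> turns the approximation of \<open>star u\<close> into
    one of \<open>star u'\<close>.\<close>
  define u' where "u' = T \<rho> u"
  obtain Hs where Hs: "set Hs \<subseteq> topspace \<H>" "u' = iter_pol pol u Hs"
    using T_iterated[OF rho u] by (auto simp: u'_def)
  have "u' \<in> S \<and> f u' \<le> f u \<and> star u' = star u"
    unfolding Hs(2)
    by (rule iter_pol_induct[OF u Hs(1)]) (auto intro: order_trans[OF f_pol] simp: star_pol)
  then have u': "u' \<in> S" "f u' \<le> f u" "star u' = star u" by auto
  have fu': "f u' < (INF x. f x) + ereal (\<sigma> * \<rho> powr p)"
    using u'(2) f_u by (rule le_less_trans)
  obtain c where c: "\<And>x. ereal c \<le> f x" using f_bounded_below by blast
  obtain v \<eta> where v: "norm (v - u') < \<rho>" "norm (\<eta> - u') \<le> \<rho>"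
    "f v < (INF x. f x) + ereal (\<sigma> * \<rho> powr p)"
    "\<And>w. f w \<ge> f v + ereal (\<sigma> * (norm (v - \<eta>) powr p - norm (w - \<eta>) powr p))"
    by (rule kadec_variational_principle[OF reflexive kadec c f_lsc rho sigma p fu']) (rule that)
  have Kv: "norm (\<iota> v - \<iota> u') < K * \<rho>"
  proof -
    have "norm (\<iota> v - \<iota> u') = norm (\<iota> (v - u'))"
      using X_in_V(1) by (simp add: linear_diff bounded_linear.linear)
    also have "\<dots> \<le> K * norm (v - u')" by (rule K_bound)
    also have "\<dots> < K * \<rho>" using v(1) K_pos by simp
    finally show ?thesis .
  qed
  have "norm (\<iota> (star u') - \<iota> (star (\<Theta> v))) \<le> norm (\<iota> (\<Theta> u') - \<iota> (\<Theta> v))"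
    using star_nonexpansive[OF u'(1) Theta_closed] Theta_id[OF u'(1)] by simp
  also have "\<dots> \<le> C\<^sub>\<Theta> * norm (\<iota> v - \<iota> u')"
    using Theta_lipschitz[of u' v] by (simp add: norm_minus_commute)
  finally have st: "norm (\<iota> (star u') - \<iota> (star (\<Theta> v))) \<le> C\<^sub>\<Theta> * norm (\<iota> v - \<iota> u')" .
  have "norm (\<iota> u' - \<iota> (star u')) < \<rho>" using T_approx[OF rho u] u'(3) by (simp add: u'_def)
  moreover have "norm (\<iota> v - \<iota> (star (\<Theta> v))) \<le> norm (\<iota> v - \<iota> u') + norm (\<iota> u' - \<iota> (star u'))
      + norm (\<iota> (star u') - \<iota> (star (\<Theta> v)))"
    using norm_triangle_ineq[of "\<iota> v - \<iota> u'" "\<iota> u' - \<iota> (star u')"]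
      norm_triangle_ineq[of "\<iota> v - \<iota> (star u')" "\<iota> (star u') - \<iota> (star (\<Theta> v))"] by simp
  moreover have "(C\<^sub>\<Theta> + 1) * norm (\<iota> v - \<iota> u') \<le> (C\<^sub>\<Theta> + 1) * (K * \<rho>)"
    using Kv C_pos by (intro mult_left_mono) auto
  ultimately have a: "norm (\<iota> v - \<iota> (star (\<Theta> v))) < (K * (C\<^sub>\<Theta> + 1) + 1) * \<rho>"
    using st by (simp add: algebra_simps)
  have b: "norm (x - u) \<le> norm (x - u') + norm (T \<rho> u - u)" for x
    using norm_triangle_ineq[of "x - u'" "u' - u"] by (simp add: u'_def)
  have "norm (v - u) < \<rho> + norm (T \<rho> u - u)" "norm (\<eta> - u) \<le> \<rho> + norm (T \<rho> u - u)"
    using b[of v] b[of \<eta>] v(1,2) by linarith+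
  with a v(3,4) show ?thesis by blast
qed

end
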